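(* Let $g=3$, $\mathfrak r=2$, $\mathfrak s=1$. Then any two elements $\sigma_1,\sigma_2\in\mathfrak D_4\cap S(3)^{open}$ are D-equivalent.
   Context: Let $p$ be an odd prime and $K=\mathbb Q(\sqrt{-\Delta})$ ($\Delta>0$ a squarefree integer) an imaginary quadratic field in which $p$ is inert. Put $\mathbb Z_{p^2}=\mathbb Z_p[\sqrt{-\Delta}]$, $\mathbb F_{p^2}=\mathbb F_p[\sqrt{-\Delta}]$; bar denotes the nontrivial automorphism over $\mathbb Z_p$, resp. $\mathbb F_p$, and tilde denotes reduction modulo $p$. Let $E=E_{21}=\mathrm{diag}(1,1,-1)$. Let $G_V(\mathbb Z_p)$ be the group of matrices $\mathfrak g=h+k\sqrt{-\Delta}$, $h,k\in M_3(\mathbb Z_p)$, with $\mathfrak gE\bar{\mathfrak g}^t=\lambda E$ for some $\lambda\in\mathbb Z_p^*$, and let $\alpha:G_V(\mathbb Z_p)\to GSp_{6}(\mathbb Z_p)$, $\alpha(\mathfrak g)=\begin{pmatrix} h& kE\\ -\Delta Ek& EhE\end{pmatrix}$. $S(3)^{open}$ is the set of matrices $\sigma=\sigma(s)=\begin{pmatrix}1_3& s\\0&p1_3\end{pmatrix}$ where $s\in M_3(\mathbb Z)$ is symmetric with entries in a fixed system of residues modulo $p$. Let $\mathbb F_{p^2}$ act on row vectors $(x,y)\in\mathbb F_p^3\times\mathbb F_p^3$ by $\sqrt{-\Delta}\cdot(x,y)=(-\Delta yE,xE)$, and let $W_\sigma\subset\mathbb F_p^{6}$ be the row space of $(1_3,\tilde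 s)$. $\mathfrak D_4$ is the set of $\sigma$ with $\dim_{\mathbb F_p}(\mathbb F_{p^2}W_\sigma)=4$. Two elements $\sigma_1,\sigma_2$ are D-equivalent if there exists $\mathfrak g\in G_V(\mathbb Z_p)$ such that $\sigma_1\alpha(\mathfrak g)\sigma_2^{-1}\in GSp_{6}(\mathbb Z_p)$. *)

theory Defs
  imports
    "HOL-Analysis.Analysis"
    "HOL-Algebra.Ideal"
    "HOL-Computational_Algebra.Polynomial_Factorial"
    "HOL-Computational_Algebra.Squarefree"
    "Berlekamp_Zassenhaus.Finite_Field"
begin

text \<open>
  The prime \<open>p\<close> is the cardinality of the type \<open>'p\<close> of class \<open>prime_card\<close>, so that the residue
  field is the library type \<open>'p mod_ring\<close>. A \<open>p\<close>-adic integer is an element of the inverse limit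
  of the rings of integers modulo \<open>p ^ n\<close>, given by its least nonnegative residues.
\<close>

typedef (overloaded) ('p::prime_card) padic_int =
  "{x :: nat \<Rightarrow> int. \<forall>n. x n \<in> {0..<int CARD('p) ^ n} \<and> x (Suc n) mod int CARD('p) ^ n = x n}"
  by (rule exI[of _ "\<lambda>_. 0"]) (use prime_card[where 'a='p] in \<open>auto simp: prime_gt_0_nat\<close>)

setup_lifting type_definition_padic_int

lemma padic_mod_Suc:
  "((a::int) mod int q ^ Suc n) mod int q ^ n = a mod int q ^ n"
  by (simp add: mod_mod_cancel)

lemma padic_prime: "prime (int CARD('p::prime_card))"
  using prime_card[where 'a='p] by simp

lemma padic_pos: "int CARD('p::prime_card) ^ n > 0"
  using padic_prime[where 'p='p] by (simp add: prime_gt_0_int)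

instantiation padic_int :: (prime_card) comm_ring_1
begin

lift_definition zero_padic_int :: "'a padic_int" is "\<lambda>_. 0"
  using padic_pos[where 'p='a] by auto

lift_definition one_padic_int :: "'a padic_int" is "\<lambda>n. 1 mod int CARD('a) ^ n"
  using padic_pos[where 'p='a] by (auto simp: padic_mod_Suc simp del: power_Suc)

lift_definition plus_padic_int :: "'a padic_int \<Rightarrow> 'a padic_int \<Rightarrow> 'a padic_int"
  is "\<lambda>x y n. (x n + y n) mod int CARD('a) ^ n"
proof -
  fix x y :: "nat \<Rightarrow> int" and n
  assume x: "\<And>n. x n \<in> {0..<int CARD('a) ^ n} \<and> x (Suc n) mod int CARD('a) ^ n = x n"
    and y: "\<And>n. y n \<in> {0..<int CARD('a) ^ n} \<and> y (Suc n) mod int CARD('a) ^ n = y n"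
  have "(x (Suc n) + y (Suc n)) mod int CARD('a) ^ n = (x n + y n) mod int CARD('a) ^ n"
    using x y by (metis mod_add_eq)
  then show "(x n + y n) mod int CARD('a) ^ n \<in> {0..<int CARD('a) ^ n} \<and>
      (x (Suc n) + y (Suc n)) mod int CARD('a) ^ Suc n mod int CARD('a) ^ n
        = (x n + y n) mod int CARD('a) ^ n"
    using padic_pos[where 'p='a] by (auto simp: padic_mod_Suc simp del: power_Suc)
qed

lift_definition times_padic_int :: "'a padic_int \<Rightarrow> 'a padic_int \<Rightarrow> 'a padic_int"
  is "\<lambda>x y n. (x n * y n) mod int CARD('a) ^ n"
proof -
  fix x y :: "nat \<Rightarrow> int" and n
  assume x: "\<And>n. x n \<in> {0..<int CARD('a) ^ n} \<and> x (Suc n) mod int CARD('a) ^ n = x n"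
    and y: "\<And>n. y n \<in> {0..<int CARD('a) ^ n} \<and> y (Suc n) mod int CARD('a) ^ n = y n"
  have "(x (Suc n) * y (Suc n)) mod int CARD('a) ^ n = (x n * y n) mod int CARD('a) ^ n"
    using x y by (metis mod_mult_eq)
  then show "(x n * y n) mod int CARD('a) ^ n \<in> {0..<int CARD('a) ^ n} \<and>
      (x (Suc n) * y (Suc n)) mod int CARD('a) ^ Suc n mod int CARD('a) ^ n
        = (x n * y n) mod int CARD('a) ^ n"
    using padic_pos[where 'p='a] by (auto simp: padic_mod_Suc simp del: power_Suc)
qed

lift_definition uminus_padic_int :: "'a padic_int \<Rightarrow> 'a padic_int"
  is "\<lambda>x n. (- x n) mod int CARD('a) ^ n"
proof -
  fix x :: "nat \<Rightarrow> int" and n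
  assume x: "\<And>n. x n \<in> {0..<int CARD('a) ^ n} \<and> x (Suc n) mod int CARD('a) ^ n = x n"
  have "(- x (Suc n)) mod int CARD('a) ^ n = (- x n) mod int CARD('a) ^ n"
    using x by (metis mod_minus_eq)
  then show "(- x n) mod int CARD('a) ^ n \<in> {0..<int CARD('a) ^ n} \<and>
      (- x (Suc n)) mod int CARD('a) ^ Suc n mod int CARD('a) ^ n = (- x n) mod int CARD('a) ^ n"
    using padic_pos[where 'p='a] by (auto simp: padic_mod_Suc simp del: power_Suc)
qed

definition minus_padic_int :: "'a padic_int \<Rightarrow> 'a padic_int \<Rightarrow> 'a padic_int"
  where "minus_padic_int x y = x + - y"

instance
proof
  fix a b c :: "'a padic_int"
  show "a + b + c = a + (b + c)"
    by transfer (simp add: mod_simps add.assoc)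
  show "a + b = b + a"
    by transfer (simp add: add.commute)
  show "0 + a = a"
    by transfer (auto simp: fun_eq_iff)
  show "- a + a = 0"
    by transfer (simp add: mod_simps)
  show "a - b = a + - b"
    by (simp add: minus_padic_int_def)
  show "a * b * c = a * (b * c)"
    by transfer (simp add: mod_simps mult.assoc)
  show "a * b = b * a"
    by transfer (simp add: mult.commute)
  show "1 * a = a"
    by transfer (auto simp: mod_simps fun_eq_iff)
  show "(a + b) * c = a * c + b * c"
    by transfer (simp add: mod_simps distrib_right)
  show "(0::'a padic_int) \<noteq> 1"
  proof (transfer, rule notI)
    assume "(\<lambda>_. 0) = (\<lambda>n. 1 mod int CARD('a) ^ n)"
    then have "0 = 1 mod int CARD('a) ^ 1" by meson
    moreover have "int CARD('a) > 1"
      using padic_prime[where 'p='a] prime_gt_1_int by blast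
    ultimately show False by simp
  qed
qed

end

instance padic_int :: (prime_card) idom
proof
  fix a b :: "'a padic_int"
  assume "a \<noteq> 0" "b \<noteq> 0"
  then show "a * b \<noteq> 0"
  proof transfer
    fix x y :: "nat \<Rightarrow> int"
    let ?p = "int CARD('a)"
    assume x: "\<forall>n. x n \<in> {0..<?p ^ n} \<and> x (Suc n) mod ?p ^ n = x n"
      and y: "\<forall>n. y n \<in> {0..<?p ^ n} \<and> y (Suc n) mod ?p ^ n = y n"
      and nz: "x \<noteq> (\<lambda>_. 0)" "y \<noteq> (\<lambda>_. 0)"
    have red: "z (k + n) mod ?p ^ n = z n"
      if "\<forall>n. z n \<in> {0..<?p ^ n} \<and> z (Suc n) mod ?p ^ n = z n" for z k n
    proof (induction k)
      case 0
      show ?case using that by simp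
    next
      case (Suc k)
      have "z (Suc k + n) mod ?p ^ n = z (Suc (k + n)) mod ?p ^ (k + n) mod ?p ^ n"
        by (simp add: mod_mod_cancel le_imp_power_dvd)
      also have "\<dots> = z n" using that Suc by simp
      finally show ?case .
    qed
    obtain m n where mn: "x m \<noteq> 0" "y n \<noteq> 0"
      using nz by (meson ext)
    show "(\<lambda>n. (x n * y n) mod ?p ^ n) \<noteq> (\<lambda>_. 0)"
    proof
      assume "(\<lambda>n. (x n * y n) mod ?p ^ n) = (\<lambda>_. 0)"
      then have "(x (m + n) * y (m + n)) mod ?p ^ (m + n) = 0" by meson
      then have d: "?p ^ (m + n) dvd x (m + n) * y (m + n)" by presburger
      have "prime_elem ?p" using padic_prime[where 'p='a] by simp
      from prime_elem_power_dvd_prod[OF d this]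
      obtain i j where ij: "i + j = m + n" "?p ^ i dvd x (m + n)" "?p ^ j dvd y (m + n)"
        by blast
      show False
      proof (cases "m \<le> i")
        case True
        then have "?p ^ m dvd x (m + n)" using ij(2) power_le_dvd by blast
        then show False using red[OF x, of n m] mn by (simp add: add.commute mod_eq_0_iff_dvd)
      next
        case False
        then have "n \<le> j" using ij(1) by simp
        then have "?p ^ n dvd y (m + n)" using ij(3) power_le_dvd by blast
        then show False using red[OF y, of m n] mn by (simp add: mod_eq_0_iff_dvd)
      qed
    qed
  qed
qed

type_synonym 'p padic = "'p padic_int fract"

definition imag_quadratic_field :: "int \<Rightarrow> complex set" where
  "imag_quadratic_field \<Delta> = {of_rat a + of_rat b * csqrt (of_int (- \<Delta>)) | a b. True}"

definition ring_of_integers :: "complex set \<Rightarrow> complex ring" where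
  "ring_of_integers K =
     \<lparr>carrier = {z \<in> K. algebraic_int z}, monoid.mult = (*), one = 1, zero = 0, add = (+)\<rparr>"

definition inert_in :: "nat \<Rightarrow> complex set \<Rightarrow> bool" where
  "inert_in p K \<longleftrightarrow>
     primeideal (PIdl\<^bsub>ring_of_integers K\<^esub> (of_nat p)) (ring_of_integers K)"

type_synonym 'a mat3 = "'a ^ 3 ^ 3"

text \<open>The index type \<open>3 + 3\<close> is a sum type, with \<open>Inl\<close> the first and \<open>Inr\<close> the last three indices.\<close>

type_synonym 'a mat6 = "'a ^ (3 + 3) ^ (3 + 3)"

definition block :: "'a mat3 \<Rightarrow> 'a mat3 \<Rightarrow> 'a mat3 \<Rightarrow> 'a mat3 \<Rightarrow> 'a mat6" where
  "block A B C D = (\<chi> i j. case (i, j) of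
      (Inl i, Inl j) \<Rightarrow> A $ i $ j | (Inl i, Inr j) \<Rightarrow> B $ i $ j
    | (Inr i, Inl j) \<Rightarrow> C $ i $ j | (Inr i, Inr j) \<Rightarrow> D $ i $ j)"

definition E21 :: "'a::comm_ring_1 mat3" where
  "E21 = (\<chi> i j. if i = j then vector [1, 1, -1] $ i else 0)"

definition GSp6 :: "'a::comm_ring_1 mat6 set" where
  "GSp6 = {M. \<exists>\<mu>. \<mu> dvd 1 \<and>
      M ** block 0 (mat 1) (- mat 1) 0 ** transpose M = mat \<mu> ** block 0 (mat 1) (- mat 1) 0}"

text \<open>
  A pair \<open>(h, k)\<close> of matrices over \<open>R\<close> stands for the matrix \<open>h + k \<surd>-\<Delta>\<close> over \<open>R[\<surd>-\<Delta>]\<close>.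
\<close>

type_synonym 'a qmat3 = "'a mat3 \<times> 'a mat3"

definition qmult :: "int \<Rightarrow> 'a::comm_ring_1 qmat3 \<Rightarrow> 'a qmat3 \<Rightarrow> 'a qmat3" where
  "qmult \<Delta> x y =
     (fst x ** fst y - mat (of_int \<Delta>) ** snd x ** snd y, fst x ** snd y + snd x ** fst y)"

definition qconj :: "'a::comm_ring_1 qmat3 \<Rightarrow> 'a qmat3" where
  "qconj x = (fst x, - snd x)"

definition qtranspose :: "'a::comm_ring_1 qmat3 \<Rightarrow> 'a qmat3" where
  "qtranspose x = (transpose (fst x), transpose (snd x))"

definition G_V :: "int \<Rightarrow> 'a::comm_ring_1 qmat3 set" where
  "G_V \<Delta> = {x. \<exists>c. c dvd 1 \<and>
      qmult \<Delta> (qmult \<Delta> x (E21, 0)) (qtranspose (qconj x)) = (mat c ** E21, 0)}"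

fun alpha :: "int \<Rightarrow> 'a::comm_ring_1 qmat3 \<Rightarrow> 'a mat6" where
  "alpha \<Delta> (h, k) = block h (k ** E21) (- (mat (of_int \<Delta>) ** E21 ** k)) (E21 ** h ** E21)"

definition residue_system :: "nat \<Rightarrow> int set \<Rightarrow> bool" where
  "residue_system p R \<longleftrightarrow> (\<forall>a. \<exists>!r. r \<in> R \<and> [r = a] (mod int p))"

definition sigma :: "int mat3 \<Rightarrow> ('p::prime_card) padic_int mat6" where
  "sigma s = block (mat 1) (map_matrix of_int s) 0 (mat (of_nat CARD('p)))"

definition S3_open :: "int set \<Rightarrow> ('p::prime_card) padic_int mat6 set" where
  "S3_open R = {sigma s | s. transpose s = s \<and> (\<forall>i j. s $ i $ j \<in> R)}"

definition join :: "'a ^ 3 \<Rightarrow> 'a ^ 3 \<Rightarrow> 'a ^ (3 + 3)" where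
  "join x y = (\<chi> i. case i of Inl i \<Rightarrow> x $ i | Inr i \<Rightarrow> y $ i)"

definition W_sigma :: "int mat3 \<Rightarrow> (('p::prime_card) mod_ring ^ (3 + 3)) set" where
  "W_sigma s = vec.span {join (mat 1 $ i) (map_matrix of_int s $ i) | i. True}"

definition sqrt_act :: "int \<Rightarrow> 'a::comm_ring_1 ^ (3 + 3) \<Rightarrow> 'a ^ (3 + 3)" where
  "sqrt_act \<Delta> v =
     (let x = (\<chi> i. v $ Inl i); y = (\<chi> i. v $ Inr i)
      in join (- (of_int \<Delta> *s (y v* E21))) (x v* E21))"

text \<open>
  The span over the quadratic extension \<open>F\<^sub>p[\<surd>-\<Delta>]\<close>, regarded as a subspace over \<open>F\<^sub>p\<close>: all sums
  of vectors \<open>(a + b \<surd>-\<Delta>) w\<close> with \<open>w\<close> in \<open>W\<close>.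
\<close>

definition quad_span :: "int \<Rightarrow> ('a::field ^ (3 + 3)) set \<Rightarrow> ('a ^ (3 + 3)) set" where
  "quad_span \<Delta> W = vec.span {a *s w + b *s sqrt_act \<Delta> w | a b w. w \<in> W}"

text \<open>
  The matrix \<open>s\<close> is determined by \<open>sigma s\<close>, because the integers embed into \<open>'p padic_int\<close>.
\<close>

definition D4 :: "int \<Rightarrow> ('p::prime_card) padic_int mat6 set" where
  "D4 \<Delta> = {sigma s | s.
     transpose s = s \<and> vec.dim (quad_span \<Delta> (W_sigma s :: ('p mod_ring ^ (3 + 3)) set)) = 4}"

abbreviation padic_mat :: "('p::prime_card) padic_int mat6 \<Rightarrow> 'p padic mat6" where
  "padic_mat \<equiv> map_matrix to_fract"

definition D_equivalent ::
  "int \<Rightarrow> ('p::prime_card) padic_int mat6 \<Rightarrow> 'p padic_int mat6 \<Rightarrow> bool" where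
  "D_equivalent \<Delta> \<sigma>\<^sub>1 \<sigma>\<^sub>2 \<longleftrightarrow>
     (\<exists>x \<in> G_V \<Delta>. padic_mat \<sigma>\<^sub>1 ** padic_mat (alpha \<Delta> x) ** matrix_inv (padic_mat \<sigma>\<^sub>2)
        \<in> padic_mat ` GSp6)"

end

theory Submission
  imports Defs
begin

text \<open>
  Write \<open>k = F\<^sub>p(\<delta>)\<close> with \<open>\<delta> = \<surd>-\<Delta>\<close>; inertness of \<open>p\<close> says that \<open>k\<close> is a field. Sending a row
  vector \<open>(x, y)\<close> to \<open>x + \<delta> y E\<close> identifies \<open>F\<^sub>p\<^sup>6\<close> with \<open>k\<^sup>3\<close>. Under it \<open>\<surd>-\<Delta>\<close> acts as
  multiplication by \<open>\<delta>\<close>, \<open>\<alpha>(g)\<close> as right multiplication by \<open>g\<close>, and the symplectic form is, up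
  to sign, the \<open>\<delta>\<close>-component of the Hermitian form \<open>N(v\<^sub>1) + N(v\<^sub>2) - N(v\<^sub>3)\<close>, where
  \<open>N(a + b \<delta>) = a\<^sup>2 + \<Delta> b\<^sup>2\<close>.

  First, D-equivalence is a statement modulo \<open>p\<close>: \<open>\<sigma>\<^sub>1 \<alpha>(g) \<sigma>\<^sub>2\<^sup>-\<^sup>1\<close> is integral as soon as \<open>\<alpha>(g)\<close>
  carries the row space of \<open>(1, s\<^sub>1)\<close> into that of \<open>(1, s\<^sub>2)\<close> over \<open>F\<^sub>p\<close>, and it is then
  automatically a symplectic similitude, because the factor \<open>p\<close> is a multiplier of both \<open>\<sigma>\<^sub>i\<close>
  and cancels (\<open>D_equivalent_if_mod_p\<close>). So it suffices to move the two subspaces \<open>W\<^sub>\<sigma>\<close> to each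
  other by unitary similitudes that lift to \<open>\<int>\<^sub>p\<close>.

  Next, let \<open>W = W\<^sub>\<sigma>\<close>, a Lagrangian of \<open>F\<^sub>p\<close>-dimension 3. If \<open>k W\<close> has dimension 4, then
  \<open>W \<inter> \<delta> W\<close> is not zero, so \<open>W\<close> contains a \<open>k\<close>-line \<open>k w\<close>, which is isotropic; and
  \<open>W = k w + F\<^sub>p u\<close> with \<open>u\<close> orthogonal to \<open>w\<close>. Possibly after changing the sign of the third
  coordinate, \<open>w\<close> is not orthogonal to \<open>(0, 1, -1)\<close>. The unitary group contains explicit
  unipotent matrices that fix \<open>(0, 1, -1)\<close>; they act transitively on the isotropic lines not
  orthogonal to it, so one of them moves \<open>k (0, 1, 1)\<close> to \<open>k w\<close>. Orthogonality then forces
  \<open>u\<close>, up to an element of \<open>k w\<close>, to be a \<open>k\<close>-multiple of the image of \<open>(1, 0, 0)\<close>, say by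
  \<open>c \<noteq> 0\<close> (\<open>lagrangian_normal_form\<close>). The scalar matrix \<open>c\<close> is a similitude with multiplier
  \<open>N(c)\<close>, and it maps \<open>k (0, 1, 1) + F\<^sub>p (1, 0, 0)\<close> to \<open>k (0, 1, 1) + F\<^sub>p c (1, 0, 0)\<close>. Hence
  every such \<open>W\<close> can be moved to the single subspace \<open>k (0, 1, 1) + F\<^sub>p (1, 0, 0)\<close> and back
  (\<open>W_sigma_carries\<close>).

  The scalars and the unipotent matrices are polynomial in parameters from \<open>\<int>\<close>, so lifting the
  parameters from \<open>F\<^sub>p\<close> to \<open>\<int>\<close> lifts the matrices without any use of Hensel's lemma. All
  computations are therefore made with integer matrices; about the \<open>p\<close>-adic integers it is
  enough to know that an integer prime to \<open>p\<close> is a unit (\<open>padic_int_of_int_unit\<close>) and that \<open>p\<close>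
  itself is not zero.
\<close>

section \<open>Inert primes and units of the p-adic integers\<close>

text \<open>
  If \<open>p\<close> divides \<open>a\<^sup>2 + \<Delta> = (a + \<delta>)(a - \<delta>)\<close>, primality of \<open>(p)\<close> makes one of \<open>(a \<plusminus> \<delta>) / p\<close> an
  algebraic integer. Subtracting its complex conjugate shows that \<open>2\<delta> / p\<close> is integral, hence
  so is its square \<open>-4\<Delta> / p\<^sup>2\<close>, which is rational; thus \<open>p\<^sup>2\<close> divides \<open>\<Delta>\<close>. The closure of the
  algebraic integers of \<open>K\<close> under sums and products is part of the ring axioms that a prime
  ideal carries.
\<close>

lemma inert_imp_no_root:
  fixes a \<Delta> :: int
  assumes p: "prime p" "odd p" and \<Delta>: "\<Delta> > 0" "squarefree \<Delta>"
    and inert: "inert_in p (imag_quadratic_field \<Delta>)"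
  shows "\<not> int p dvd a\<^sup>2 + \<Delta>"
proof
  assume "int p dvd a\<^sup>2 + \<Delta>"
  then obtain m where m: "a\<^sup>2 + \<Delta> = int p * m" by (elim dvdE)
  define \<delta> where "\<delta> = csqrt (of_int (- \<Delta>))"
  define K where "K = imag_quadratic_field \<Delta>"
  define O' where "O' = ring_of_integers K"
  have O_simps: "carrier O' = {z \<in> K. algebraic_int z}"
      "x \<otimes>\<^bsub>O'\<^esub> y = x * y" "x \<oplus>\<^bsub>O'\<^esub> y = x + y" for x y
    by (simp_all add: O'_def ring_of_integers_def)
  interpret I: primeideal "PIdl\<^bsub>O'\<^esub> (of_nat p)" O'
    using inert by (simp add: inert_in_def O'_def K_def)
  have K_I: "of_rat r + of_rat t * \<delta> \<in> K" for r t
    by (auto simp: K_def imag_quadratic_field_def \<delta>_def)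
  have sq: "\<delta> * \<delta> = - of_int \<Delta>"
    by (simp add: \<delta>_def flip: power2_eq_square)
  have cnj_\<delta>: "cnj \<delta> = - \<delta>"
    using \<Delta>(1) csqrt_of_real_nonpos[of "of_int (- \<Delta>)"] by (simp add: \<delta>_def)
  have int_in: "of_int k \<in> carrier O'" for k
    using K_I[of "of_int k" 0] by (auto simp: O_simps intro: int_imp_algebraic_int)
  have alg_\<delta>: "algebraic_int \<delta>"
    unfolding \<delta>_def by (intro algebraic_int_csqrt int_imp_algebraic_int Ints_of_int)
  have \<delta>_in: "\<delta> \<in> carrier O'" "- \<delta> \<in> carrier O'"
    using K_I[of 0 1] K_I[of 0 "-1"] alg_\<delta> by (simp_all add: O_simps)
  have cnj_in: "cnj z \<in> carrier O'" if z: "z \<in> carrier O'" for z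
  proof -
    from z obtain r t where "z = of_rat r + of_rat t * \<delta>"
      by (auto simp: O_simps K_def imag_quadratic_field_def \<delta>_def)
    moreover have "cnj (of_rat x) = of_rat x" for x by (cases x) (simp add: of_rat_rat)
    ultimately have "cnj z = of_rat r + of_rat (- t) * \<delta>"
      by (simp add: cnj_\<delta> of_rat_minus)
    then have "cnj z \<in> K" by (simp only: K_I)
    then show ?thesis using z by (simp add: O_simps)
  qed
  have a_in: "of_int a + \<delta> \<in> carrier O'" "of_int a + - \<delta> \<in> carrier O'"
    using I.a_closed[OF int_in \<delta>_in(1), of a] I.a_closed[OF int_in \<delta>_in(2), of a]
    by (simp_all add: O_simps(3))
  have "(of_int a + \<delta>) * (of_int a + - \<delta>) = of_int (a\<^sup>2 + \<Delta>)"
    using sq by (simp add: algebra_simps power2_eq_square)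
  also have "\<dots> = of_int m * of_nat p" by (simp add: m)
  also have "\<dots> \<in> PIdl\<^bsub>O'\<^esub> (of_nat p)"
    using int_in[of m] unfolding cgenideal_def O_simps(2) by blast
  finally have "of_int a + \<delta> \<in> PIdl\<^bsub>O'\<^esub> (of_nat p) \<or> of_int a + - \<delta> \<in> PIdl\<^bsub>O'\<^esub> (of_nat p)"
    using I.I_prime[OF a_in] by (simp add: O_simps(2))
  then obtain e z :: complex where e: "e = 1 \<or> e = -1" and z: "z \<in> carrier O'"
      and eq: "of_int a + e * \<delta> = z * of_nat p"
    unfolding cgenideal_def O_simps(2) by force
  \<comment> \<open>The number \<open>v\<close> is \<open>2\<delta> / p\<close> up to sign.\<close>
  define v where "v = z + - cnj z"
  have "- cnj z \<in> carrier O'"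
    using I.m_closed[OF int_in cnj_in[OF z], of "-1"] by (simp add: O_simps(2))
  then have "v \<in> carrier O'"
    using I.a_closed[OF z] unfolding v_def O_simps(3) by blast
  then have "v * v \<in> carrier O'"
    using I.m_closed unfolding O_simps(2) by blast
  then have alg: "algebraic_int (v * v)" by (simp add: O_simps(1))
  have "of_int a - e * \<delta> = cnj z * of_nat p"
    using arg_cong[OF eq, of cnj] e cnj_\<delta> by auto
  then have "v * of_nat p = 2 * e * \<delta>"
    using eq by (simp add: v_def algebra_simps)
  then have "(v * of_nat p) * (v * of_nat p) = 4 * (e * e) * (\<delta> * \<delta>)"
    by (simp add: algebra_simps)
  also have "e * e = 1" using e by auto
  finally have vv: "v * v * of_nat (p * p) = of_int (- 4 * \<Delta>)"
    by (simp add: sq algebra_simps)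
  then have "v * v = of_int (- 4 * \<Delta>) / of_nat (p * p)"
    using p(1) by (simp add: field_simps prime_gt_0_nat)
  then have "v * v \<in> \<rat>" by simp
  with alg have "v * v \<in> \<int>" by (simp add: rational_algebraic_int_is_int)
  then obtain N where "v * v = of_int N" by (elim Ints_cases)
  with vv have "(of_int (N * int (p * p)) :: complex) = of_int (- 4 * \<Delta>)" by simp
  then have N: "N * int (p * p) = - 4 * \<Delta>" by (simp only: of_int_eq_iff)
  then have "int (p * p) dvd 4 * \<Delta>" 
    by (metis dvd_minus_iff dvd_triv_right mult_minus_left)
  moreover have "coprime (int (p * p)) 4"
  proof -
    have "coprime (int p) 2" using p by simp
    then have "coprime (int p * int p) (2 * 2)" by (simp only: coprime_mult_left_iff coprime_mult_right_iff)
    then show ?thesis by simp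
  qed
  ultimately have "(int p)\<^sup>2 dvd \<Delta>"
    by (simp add: coprime_dvd_mult_right_iff power2_eq_square)
  with \<Delta>(2) have "int p dvd 1" by (rule squarefreeD)
  with p(1) show False by (simp add: prime_gt_1_nat)
qed

lemma of_int_mod_ring_eq_0_iff:
  "(of_int n :: 'p::prime_card mod_ring) = 0 \<longleftrightarrow> int CARD('p) dvd n"
  unfolding of_int_of_int_mod_ring by transfer (simp add: mod_eq_0_iff_dvd)

lemma Rep_padic_int_of_int:
  "Rep_padic_int (of_int n :: 'p::prime_card padic_int) k = n mod int CARD('p) ^ k"
proof -
  have nat: "Rep_padic_int (of_nat m :: 'p padic_int) k = int m mod int CARD('p) ^ k" for m
    by (induction m) (simp_all add: zero_padic_int.rep_eq one_padic_int.rep_eq plus_padic_int.rep_eq mod_simps)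
  show ?thesis
    by (cases n rule: int_cases2) (simp_all add: nat uminus_padic_int.rep_eq mod_simps)
qed

lemma of_nat_card_padic_int_nonzero: "of_nat CARD('p) \<noteq> (0 :: 'p::prime_card padic_int)"
proof
  assume "of_nat CARD('p) = (0 :: 'p padic_int)"
  then have "Rep_padic_int (of_int (int CARD('p)) :: 'p padic_int) 2 = 0"
    by (simp add: zero_padic_int.rep_eq)
  then have "int CARD('p) ^ 2 dvd int CARD('p)"
    by (simp add: Rep_padic_int_of_int mod_eq_0_iff_dvd del: of_nat_dvd_iff of_int_of_nat_eq)
  then show False
    using padic_prime[where 'p='p] by (simp add: power2_eq_square)
qed

text \<open>
  The inverses of \<open>n\<close> modulo the powers of \<open>p\<close> are unique, hence compatible, and define a
  \<open>p\<close>-adic integer.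
\<close>

lemma padic_int_of_int_unit:
  assumes "\<not> int CARD('p) dvd n"
  shows "of_int n dvd (1 :: 'p::prime_card padic_int)"
proof -
  let ?p = "int CARD('p)"
  have cop: "coprime n (?p ^ k)" for k
    using assms padic_prime[where 'p='p] by (metis coprime_commute coprime_power_right_iff prime_imp_coprime)
  then have "\<forall>k. \<exists>x. [n * x = 1] (mod ?p ^ k)"
    by (simp add: cong_solve_coprime_int)
  then obtain x where x: "\<And>k. [n * x k = 1] (mod ?p ^ k)" by metis
  define y where "y k = x k mod ?p ^ k" for k
  have y: "[n * y k = 1] (mod ?p ^ k)" for k
    using x[of k] by (simp add: y_def cong_def mod_simps)
  have "y (Suc k) mod ?p ^ k = y k" for k
  proof -
    have "[n * y (Suc k) = 1] (mod ?p ^ k)"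
      using y[of "Suc k"] by (rule cong_dvd_modulus) (simp add: le_imp_power_dvd)
    with y[of k] have "[n * y (Suc k) = n * y k] (mod ?p ^ k)"
      using cong_sym cong_trans by blast
    then have "[y (Suc k) = y k] (mod ?p ^ k)"
      using cop[of k] by (simp add: cong_mult_lcancel)
    then show ?thesis by (simp add: cong_def y_def)
  qed
  then have R: "Rep_padic_int (Abs_padic_int y :: 'p padic_int) = y"
    by (intro Abs_padic_int_inverse) (auto simp: y_def padic_pos)
  have "of_int n * (Abs_padic_int y :: 'p padic_int) = (1 :: 'p padic_int)"
    unfolding Rep_padic_int_inject[symmetric]
  proof
    fix k
    show "Rep_padic_int (of_int n * (Abs_padic_int y :: 'p padic_int)) k = Rep_padic_int (1 :: 'p padic_int) k"
      using y[of k] by (simp add: times_padic_int.rep_eq one_padic_int.rep_eq R Rep_padic_int_of_int cong_def mod_simps)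
  qed
  then show ?thesis by (metis dvd_triv_left)
qed

section \<open>Matrices over a commutative ring and block matrices\<close>

lemma matrix_mult_minus_left: "(- A) ** B = - (A ** (B :: 'a::ring_1^'n^'m))"
  by (simp add: matrix_matrix_mult_def vec_eq_iff sum_negf)

lemma matrix_mult_minus_right: "A ** (- B) = - (A ** (B :: 'a::ring_1^'n^'m))"
  by (simp add: matrix_matrix_mult_def vec_eq_iff sum_negf)

lemma matrix_mult_add_left: "(A + B) ** C = A ** C + B ** (C :: 'a::semiring_1^'n^'m)"
  by (simp add: matrix_matrix_mult_def vec_eq_iff distrib_right sum.distrib)

lemma matrix_mult_diff_left: "(A - B) ** C = A ** C - B ** (C :: 'a::ring_1^'n^'m)"
  by (simp add: matrix_matrix_mult_def vec_eq_iff left_diff_distrib sum_subtractf)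

lemma matrix_mult_diff_right: "A ** (B - C) = A ** B - A ** (C :: 'a::ring_1^'n^'m)"
  by (simp add: matrix_matrix_mult_def vec_eq_iff right_diff_distrib sum_subtractf)

lemma matrix_mult_zero_left: "0 ** A = (0 :: 'a::semiring_1^'n^'m)"
  by (simp add: matrix_matrix_mult_def vec_eq_iff)

lemma matrix_mult_zero_right: "A ** 0 = (0 :: 'a::semiring_1^'n^'m)"
  by (simp add: matrix_matrix_mult_def vec_eq_iff)

lemma mat_mult_nth: "(mat c ** A) $ i $ j = c * (A :: 'a::semiring_1^'n^'m) $ i $ j"
  by (simp add: matrix_matrix_mult_def mat_def if_distrib if_distribR cong: if_cong)

lemma mult_mat_nth: "(A ** mat c) $ i $ j = (A :: 'a::semiring_1^'n^'m) $ i $ j * c"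
  by (simp add: matrix_matrix_mult_def mat_def if_distrib if_distribR cong: if_cong)

lemma mat_commute: "A ** mat c = mat c ** (A :: 'a::comm_semiring_1^'n^'m)"
  by (simp add: vec_eq_iff mat_mult_nth mult_mat_nth mult.commute)

lemma mat_left_commute:
  "A ** (mat c ** B) = mat c ** (A ** (B :: 'a::comm_semiring_1^'n^'m))"
  by (metis mat_commute matrix_mul_assoc)

lemma mat_right_commute:
  "A ** (B ** mat c) = mat c ** (A ** (B :: 'a::comm_semiring_1^'n^'m))"
  using mat_commute[of "A ** B" c] by (simp only: matrix_mul_assoc)

lemma mat_mult_mat: "mat a ** mat b = (mat (a * b) :: 'a::semiring_1^'n^'n)"
  by (simp add: vec_eq_iff mat_mult_nth) (simp add: mat_def)

lemma transpose_add: "transpose (A + B) = transpose A + transpose B"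
  and transpose_diff: "transpose (A' - B') = transpose A' - transpose B'"
  and transpose_minus: "transpose (- A') = - transpose A'"
  and transpose_0: "transpose 0 = 0"
  for A B :: "'a::monoid_add^'n^'m" and A' B' :: "'b::ring_1^'n^'m"
  by (simp_all add: transpose_def vec_eq_iff)

text \<open>
  As a rewrite rule \<open>mat_left_commute\<close> terminates only while a product contains a single
  scalar matrix.
\<close>

lemmas matrix_ring_simps = matrix_mul_assoc[symmetric] matrix_add_ldistrib matrix_mult_add_left
  matrix_mult_minus_left matrix_mult_minus_right matrix_mult_diff_left matrix_mult_diff_right
  matrix_mult_zero_left matrix_mult_zero_right mat_left_commute
  matrix_transpose_mul transpose_add transpose_diff transpose_minus transpose_0

lemma E21_mult_E21: "E21 ** E21 = (mat 1 :: 'a::comm_ring_1 mat3)"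
  by (simp add: vec_eq_iff forall_3 E21_def matrix_matrix_mult_def sum_3 mat_def)

lemma transpose_E21: "transpose E21 = (E21 :: 'a::comm_ring_1 mat3)"
  by (simp add: vec_eq_iff forall_3 E21_def transpose_def)

lemma E21_mult_E21_left: "E21 ** (E21 ** A) = (A :: 'a::comm_ring_1 mat3)"
  by (simp add: matrix_mul_assoc E21_mult_E21)

lemma map_of_int_mult:
  "map_matrix of_int (A ** B) = map_matrix of_int A ** (map_matrix of_int B :: 'a::ring_1^'n^'m)"
  by (simp add: vec_eq_iff matrix_matrix_mult_def)

lemma map_of_int_add: "map_matrix of_int (A + B) = map_matrix of_int A + (map_matrix of_int B :: 'a::ring_1^'n^'m)"
  and map_of_int_diff: "map_matrix of_int (A - B) = map_matrix of_int A - (map_matrix of_int B :: 'a::ring_1^'n^'m)"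
  and map_of_int_minus: "map_matrix of_int (- A) = - (map_matrix of_int A :: 'a::ring_1^'n^'m)"
  and map_of_int_0: "map_matrix of_int 0 = (0 :: 'a::ring_1^'n^'m)"
  by (simp_all add: vec_eq_iff)

lemma map_of_int_mat: "map_matrix of_int (mat c) = (mat (of_int c) :: 'a::ring_1^'n^'n)"
  by (simp add: vec_eq_iff mat_def)

lemma map_of_int_transpose:
  "map_matrix of_int (transpose A) = transpose (map_matrix of_int A :: 'a::ring_1^'n^'m)"
  by (simp add: vec_eq_iff transpose_def)

lemma map_of_int_E21: "map_matrix of_int E21 = (E21 :: 'a::comm_ring_1 mat3)"
  by (simp add: vec_eq_iff E21_def forall_3)

lemma map_of_int_block:
  "map_matrix of_int (block A B C D) = (block (map_matrix of_int A) (map_matrix of_int B)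
     (map_matrix of_int C) (map_matrix of_int D) :: 'a::ring_1 mat6)"
  by (simp add: vec_eq_iff block_def split_sum_all)

lemmas map_of_int_simps = map_of_int_mult map_of_int_add map_of_int_diff map_of_int_minus
  map_of_int_0 map_of_int_mat map_of_int_transpose map_of_int_E21 map_of_int_block

lemma sum_UNIV_Plus:
  "sum f (UNIV :: ('a::finite + 'b::finite) set) = (\<Sum>i\<in>UNIV. f (Inl i)) + (\<Sum>i\<in>UNIV. f (Inr i))"
  by (simp add: sum.Plus flip: UNIV_Plus_UNIV)

lemma block_mult:
  "block A B C D ** block A' B' C' D' =
     block (A ** A' + B ** C') (A ** B' + B ** D') (C ** A' + D ** C') (C ** B' + D ** D')"
  for A :: "'a::semiring_1 mat3"
  by (simp add: vec_eq_iff block_def split_sum_all matrix_matrix_mult_def sum_UNIV_Plus)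

lemma transpose_block:
  "transpose (block A B C D) = block (transpose A) (transpose C) (transpose B) (transpose D)"
  by (simp add: vec_eq_iff block_def split_sum_all transpose_def)

lemma mat_block: "mat c = (block (mat c) 0 0 (mat c) :: 'a::semiring_1 mat6)"
  by (simp add: vec_eq_iff block_def split_sum_all mat_def)

lemma join_mult_block:
  "join x y v* block A B C D = join (x v* A + y v* C) (x v* B + y v* (D :: 'a::semiring_1 mat3))"
  by (simp add: vec_eq_iff block_def join_def split_sum_all vector_matrix_mult_def sum_UNIV_Plus)

section \<open>Unitary similitudes and their images in the symplectic group\<close>

lemma alpha_qmult: "alpha \<Delta> (qmult \<Delta> g g') = alpha \<Delta> g ** (alpha \<Delta> g' :: 'a::comm_ring_1 mat6)"
  by (cases g; cases g') 
    (simp add: qmult_def block_mult matrix_ring_simps E21_mult_E21_left algebra_simps)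

lemma map_of_int_alpha:
  "map_matrix of_int (alpha \<Delta> (h, k)) =
     (alpha \<Delta> (map_matrix of_int h, map_matrix of_int k) :: 'a::comm_ring_1 mat6)"
  by (simp add: map_of_int_simps)

text \<open>
  The group \<open>G_V\<close> with its multiplier \<open>c\<close> made explicit and not yet required to be a unit, so
  that the notion is useful over the integers.
\<close>

definition similitude :: "int \<Rightarrow> 'a::comm_ring_1 \<Rightarrow> 'a qmat3 \<Rightarrow> bool" where
  "similitude \<Delta> c g \<longleftrightarrow>
     qmult \<Delta> (qmult \<Delta> g (E21, 0)) (qtranspose (qconj g)) = (mat c ** E21, 0)"

lemma similitude_iff:
  "similitude \<Delta> c (h, k) \<longleftrightarrow>
     h ** E21 ** transpose h + mat (of_int \<Delta>) ** k ** E21 ** transpose k = mat c ** E21 \<and>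
     k ** E21 ** transpose h = h ** E21 ** transpose k"
  by (simp add: similitude_def qmult_def qtranspose_def qconj_def matrix_ring_simps algebra_simps)

lemma qmult_assoc: "qmult \<Delta> (qmult \<Delta> x y) z = qmult \<Delta> x (qmult \<Delta> y z)"
  by (simp add: qmult_def matrix_ring_simps algebra_simps)

lemma similitude_qmult:
  assumes "similitude \<Delta> c g" "similitude \<Delta> c' g'"
  shows "similitude \<Delta> (c * c') (qmult \<Delta> g g')"
proof -
  let ?star = "\<lambda>x. qtranspose (qconj x)"
  have star: "?star (qmult \<Delta> g g') = qmult \<Delta> (?star g') (?star g)"
  proof -
    obtain h k h' k' where g: "g = (h, k)" "g' = (h', k')" by (cases g; cases g')
    have t: "transpose (mat (of_int \<Delta>) ** k ** k') = mat (of_int \<Delta>) ** (transpose k' ** transpose k)"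
      by (simp add: matrix_transpose_mul mat_right_commute)
    show ?thesis
      by (simp only: g qmult_def qtranspose_def qconj_def fst_conv snd_conv transpose_minus
            transpose_diff transpose_add t matrix_transpose_mul[of h] matrix_transpose_mul[of k])
        (simp add: matrix_mult_minus_left matrix_mult_minus_right matrix_mul_assoc)
  qed
  have scal: "qmult \<Delta> (qmult \<Delta> x (mat c' ** A, 0)) y = (mat c' ** fst (qmult \<Delta> (qmult \<Delta> x (A, 0)) y),
      mat c' ** snd (qmult \<Delta> (qmult \<Delta> x (A, 0)) y))" for x y and A :: "'a mat3"
    by (simp add: qmult_def matrix_mul_assoc[symmetric] mat_left_commute[of _ c'] matrix_mult_diff_right
        matrix_add_ldistrib matrix_mult_zero_left matrix_mult_zero_right)
  let ?X = "qmult \<Delta> (qmult \<Delta> g (E21, 0)) (?star g)"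
  have "qmult \<Delta> (qmult \<Delta> (qmult \<Delta> g g') (E21, 0)) (?star (qmult \<Delta> g g')) =
      qmult \<Delta> (qmult \<Delta> g (qmult \<Delta> (qmult \<Delta> g' (E21, 0)) (?star g'))) (?star g)"
    by (simp only: star qmult_assoc)
  also have "\<dots> = qmult \<Delta> (qmult \<Delta> g (mat c' ** E21, 0)) (?star g)"
    using assms(2) by (simp only: similitude_def)
  also have "\<dots> = (mat c' ** fst ?X, mat c' ** snd ?X)"
    by (rule scal)
  also have "?X = (mat c ** E21, 0)"
    using assms(1) by (simp only: similitude_def)
  finally show ?thesis
    by (simp only: similitude_def fst_conv snd_conv matrix_mul_assoc mat_mult_mat mult.commute matrix_mult_zero_right)
qed

lemma similitude_of_int:
  assumes "similitude \<Delta> c (h, k)"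
  shows "similitude \<Delta> (of_int c) (map_matrix of_int h, map_matrix of_int k :: 'a::comm_ring_1 mat3)"
proof -
  have a: "h ** E21 ** transpose h + mat (of_int \<Delta>) ** k ** E21 ** transpose k = mat c ** E21"
    and b: "k ** E21 ** transpose h = h ** E21 ** transpose k"
    using assms by (simp_all add: similitude_iff)
  show ?thesis
    using arg_cong[OF a, of "map_matrix (of_int :: int \<Rightarrow> 'a)"] arg_cong[OF b, of "map_matrix (of_int :: int \<Rightarrow> 'a)"]
    by (simp add: similitude_iff map_of_int_simps)
qed

abbreviation symp_J :: "'a::comm_ring_1 mat6" where
  "symp_J \<equiv> block 0 (mat 1) (- mat 1) 0"


text \<open>
  The block entries of \<open>\<alpha>(g) J \<alpha>(g)\<^sup>t\<close> are, up to factors \<open>E\<close> on either side, the two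
  components of \<open>g E g\<^sup>*\<close>; each of the facts in the proof is one of them with the factors \<open>E\<close>
  that its block requires.
\<close>

lemma alpha_symplectic:
  assumes "similitude \<Delta> c g"
  shows "alpha \<Delta> g ** symp_J ** transpose (alpha \<Delta> g) = mat c ** symp_J"
proof (cases g)
  case (Pair h k)
  have a: "h ** (E21 ** transpose h) + mat (of_int \<Delta>) ** (k ** (E21 ** transpose k)) = mat c ** E21"
    and b: "k ** (E21 ** transpose h) = h ** (E21 ** transpose k)"
    using assms by (simp_all add: similitude_iff Pair matrix_mul_assoc)
  have a1: "mat (of_int \<Delta>) ** (k ** (E21 ** (transpose k ** E21))) + h ** (E21 ** (transpose h ** E21)) = mat c"
    using arg_cong[OF a, of "\<lambda>X. X ** E21"] by (simp add: matrix_ring_simps E21_mult_E21 add.commute)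
  have a2: "E21 ** (h ** (E21 ** transpose h)) + mat (of_int \<Delta>) ** (E21 ** (k ** (E21 ** transpose k))) = mat c"
    using arg_cong[OF a, of "\<lambda>X. E21 ** X"] by (simp add: matrix_ring_simps E21_mult_E21)
  have a3: "- (E21 ** (h ** (E21 ** transpose h))) - mat (of_int \<Delta>) ** (E21 ** (k ** (E21 ** transpose k))) = - mat c"
    by (simp flip: a2)
  have b1: "E21 ** (k ** (E21 ** (transpose h ** E21))) = E21 ** (h ** (E21 ** (transpose k ** E21)))"
    using arg_cong[OF b, of "\<lambda>X. E21 ** (X ** E21)"] by (simp add: matrix_ring_simps)
  show ?thesis
    using a1 a3 b b1
    by (simp add: Pair block_mult transpose_block mat_block[of c] matrix_ring_simps transpose_E21
        E21_mult_E21_left mat_commute[of E21])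
qed

section \<open>Reduction to subspaces over the residue field\<close>

lemma W_sigma_graph:
  "(W_sigma s :: ('p::prime_card mod_ring ^ (3 + 3)) set) = {join x (x v* map_matrix of_int s) | x. True}"
proof
  let ?S = "map_matrix of_int s :: 'p mod_ring mat3"
  have "vec.subspace {join x (x v* ?S) | x. True}"
    unfolding vec.subspace_def
  proof (intro conjI ballI allI)
    show "0 \<in> {join x (x v* ?S) | x. True}"
      by (auto intro!: exI[of _ 0] simp: vec_eq_iff join_def split_sum_all)
    fix u assume "u \<in> {join x (x v* ?S) | x. True}"
    then obtain x where u: "u = join x (x v* ?S)" by blast
    {
      fix c
      have "c *s u = join (c *s x) ((c *s x) v* ?S)"
        by (simp add: u vec_eq_iff join_def split_sum_all vector_matrix_mult_def sum_distrib_left mult_ac)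
      then show "c *s u \<in> {join x (x v* ?S) | x. True}" by blast
    next
      fix v assume "v \<in> {join x (x v* ?S) | x. True}"
      then obtain y where v: "v = join y (y v* ?S)" by blast
      have "u + v = join (x + y) ((x + y) v* ?S)"
        by (simp add: u v vec_eq_iff join_def split_sum_all vector_matrix_left_distrib)
      then show "u + v \<in> {join x (x v* ?S) | x. True}" by blast
    }
  qed
  moreover have "join (mat 1 $ i) (?S $ i) \<in> {join x (x v* ?S) | x. True}" for i
  proof -
    have "?S $ i = mat 1 $ i v* ?S"
      by (simp add: vec_eq_iff vector_matrix_mult_def mat_def if_distrib if_distribR cong: if_cong)
    then show ?thesis by (metis (mono_tags, lifting) mem_Collect_eq)
  qed
  ultimately show "W_sigma s \<subseteq> {join x (x v* ?S) | x. True}"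
    unfolding W_sigma_def by (intro vec.span_minimal) auto
  show "{join x (x v* ?S) | x. True} \<subseteq> W_sigma s"
  proof safe
    fix x :: "'p mod_ring ^ 3"
    have "join x (x v* ?S) = (\<Sum>i\<in>UNIV. x $ i *s join (mat 1 $ i) (?S $ i))"
      by (simp add: vec_eq_iff join_def split_sum_all vector_matrix_mult_def mat_def mult_ac
          if_distrib if_distribR cong: if_cong)
    also have "\<dots> \<in> W_sigma s"
      unfolding W_sigma_def by (intro vec.span_sum vec.span_scale vec.span_base) blast
    finally show "join x (x v* ?S) \<in> W_sigma s" .
  qed
qed

lemma join_eq_iff: "join x y = join x' y' \<longleftrightarrow> x = x' \<and> y = y'"
  by (auto simp: vec_eq_iff join_def split_sum_all)

lemma vector_matrix_eqI:
  assumes "\<And>x. x v* A = x v* (B :: 'a::comm_semiring_1^'n^'m)"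
  shows "A = B"
proof -
  have "A $ i $ j = B $ i $ j" for i j
    using arg_cong[OF assms[of "\<chi> k. if k = i then 1 else 0"], of "\<lambda>v. v $ j"]
    by (simp add: vector_matrix_mult_def if_distrib if_distribR cong: if_cong)
  then show ?thesis by (simp add: vec_eq_iff)
qed

lemma sigma_of_int:
  "(sigma s :: 'p::prime_card padic_int mat6) = map_matrix of_int (block (mat 1) s 0 (mat (int CARD('p))))"
  for s :: "int mat3"
  unfolding sigma_def map_of_int_simps by simp

lemma symplectic_sigma:
  fixes s :: "'a::comm_ring_1 mat3"
  assumes "transpose s = s"
  shows "block (mat 1) s 0 (mat q) ** symp_J ** transpose (block (mat 1) s 0 (mat q)) = mat q ** symp_J"
  using assms
  by (simp add: block_mult transpose_block mat_block[of q] matrix_ring_simps mat_commute[of _ q])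

lemma to_fract_of_nat: "to_fract (of_nat n) = of_nat n"
  by (induction n) simp_all

lemma to_fract_of_int: "to_fract (of_int n) = of_int n"
  by (cases n rule: int_cases2) (simp_all add: to_fract_of_nat)

lemma sigma_invertible:
  fixes s :: "'a::field mat3"
  assumes "q \<noteq> 0"
  shows "invertible (block (mat 1) s 0 (mat q))"
  unfolding invertible_def
  by (rule exI[of _ "block (mat 1) (- (s ** mat (inverse q))) 0 (mat (inverse q))"])
    (use assms in \<open>simp add: block_mult mat_block[of 1] matrix_mult_minus_left matrix_mult_zero_left
       matrix_mult_zero_right mat_mult_mat flip: matrix_mul_assoc\<close>)

lemma invertible_mult_matrix_inv: "invertible A \<Longrightarrow> A ** matrix_inv A = mat 1"
  unfolding matrix_inv_def invertible_def by (rule conjunct1[OF someI_ex])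

text \<open>
  With \<open>\<alpha>(g) = (A, B; C, D)\<close>, the hypothesis says that \<open>(A + s C) t\<close> and \<open>B + s D\<close> agree
  modulo \<open>p\<close>. This congruence is all that is needed for an integer matrix \<open>M\<close> with
  \<open>M \<sigma>(t) = \<sigma>(s) \<alpha>(g)\<close>. Both \<open>\<sigma>(s)\<close> and \<open>\<sigma>(t)\<close> are symplectic with multiplier \<open>p\<close>, so
  \<open>p M J M\<^sup>t = p c J\<close> and \<open>M\<close> has multiplier \<open>c\<close>.
\<close>

lemma D_equivalent_if_mod_p:
  fixes g :: "int qmat3"
  assumes sym: "transpose s = s" "transpose t = t"
    and g: "similitude \<Delta> c g" and c: "\<not> int CARD('p) dvd c"
    and maps: "\<And>v. v \<in> W_sigma s \<Longrightarrow>
      v v* map_matrix of_int (alpha \<Delta> g) \<in> (W_sigma t :: ('p::prime_card mod_ring ^ (3 + 3)) set)"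
  shows "D_equivalent \<Delta> (sigma s) (sigma t :: 'p padic_int mat6)"
proof -
  let ?p = "int CARD('p)"
  let ?red = "map_matrix of_int :: int mat3 \<Rightarrow> 'p mod_ring mat3"
  obtain h k where hk: "g = (h, k)" by (cases g)
  obtain A B C D where abcd: "alpha \<Delta> g = block A B C D"
    unfolding hk by (simp only: alpha.simps)
  let ?P = "A + s ** C" and ?Q = "B + s ** D"
  have "?red (?P ** t) = ?red ?Q"
  proof (rule vector_matrix_eqI)
    fix x :: "'p mod_ring ^ 3"
    have "join x (x v* ?red s) \<in> W_sigma s" unfolding W_sigma_graph by blast
    from maps[OF this] have "join (x v* ?red ?P) (x v* ?red ?Q) \<in> W_sigma t"
      by (simp add: abcd map_of_int_simps join_mult_block vector_matrix_mul_assoc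
          vector_matrix_mult_add_rdistrib)
    then show "x v* ?red (?P ** t) = x v* ?red ?Q"
      by (auto simp: W_sigma_graph join_eq_iff map_of_int_mult vector_matrix_mul_assoc)
  qed
  then have "?p dvd (?Q - ?P ** t) $ i $ j" for i j
    by (simp add: vec_eq_iff flip: of_int_mod_ring_eq_0_iff[where 'p='p])
  then have "\<exists>x. (?Q - ?P ** t) $ i $ j = ?p * x" for i j
    by (simp only: dvd_def)
  then obtain T' where T': "\<And>i j. (?Q - ?P ** t) $ i $ j = ?p * T' i j" by metis
  define T where "T = (\<chi> i j. T' i j)"
  have T: "?Q = ?P ** t + mat ?p ** T"
    using T' by (simp add: vec_eq_iff mat_mult_nth T_def algebra_simps)
  define \<sigma> where "\<sigma> s = block (mat 1) s 0 (mat ?p)" for s :: "int mat3"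
  define M where "M = block ?P T (mat ?p ** C) (D - C ** t)"
  have M: "M ** \<sigma> t = \<sigma> s ** alpha \<Delta> g"
    using T by (simp add: M_def \<sigma>_def abcd block_mult matrix_ring_simps mat_commute[of _ ?p] algebra_simps)
  have "mat ?p ** (M ** symp_J ** transpose M) = M ** (mat ?p ** symp_J) ** transpose M"
    by (simp add: matrix_ring_simps)
  also have "\<dots> = M ** (\<sigma> t ** symp_J ** transpose (\<sigma> t)) ** transpose M"
    by (simp add: \<sigma>_def symplectic_sigma sym)
  also have "\<dots> = (M ** \<sigma> t) ** symp_J ** transpose (M ** \<sigma> t)"
    by (simp add: matrix_transpose_mul matrix_mul_assoc)
  also have "\<dots> = \<sigma> s ** (alpha \<Delta> g ** symp_J ** transpose (alpha \<Delta> g)) ** transpose (\<sigma> s)"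
    by (simp add: M matrix_transpose_mul matrix_mul_assoc)
  also have "\<dots> = \<sigma> s ** (mat c ** symp_J) ** transpose (\<sigma> s)"
    by (simp only: alpha_symplectic[OF g])
  also have "\<dots> = mat c ** (\<sigma> s ** symp_J ** transpose (\<sigma> s))"
    by (simp only: mat_left_commute flip: matrix_mul_assoc)
  also have "\<dots> = mat c ** (mat ?p ** symp_J)"
    by (simp add: \<sigma>_def symplectic_sigma sym)
  also have "\<dots> = mat ?p ** (mat c ** symp_J)"
    by (rule mat_left_commute)
  finally have "M ** symp_J ** transpose M = mat c ** symp_J"
    by (simp add: vec_eq_iff mat_mult_nth)
  then have "map_matrix of_int (M ** symp_J ** transpose M) =
      (map_matrix of_int (mat c ** symp_J) :: 'p padic_int mat6)"
    by (rule arg_cong)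
  then have "map_matrix of_int M ** symp_J ** transpose (map_matrix of_int M) =
      (mat (of_int c) ** symp_J :: 'p padic_int mat6)"
    by (simp only: map_of_int_simps of_int_1)
  then have GSp: "map_matrix of_int M \<in> (GSp6 :: 'p padic_int mat6 set)"
    using padic_int_of_int_unit[OF c] by (auto simp: GSp6_def)
  define g' :: "'p padic_int qmat3" where "g' = (map_matrix of_int h, map_matrix of_int k)"
  have g': "g' \<in> G_V \<Delta>"
    using similitude_of_int[of \<Delta> c h k] g padic_int_of_int_unit[OF c]
    by (auto simp: G_V_def similitude_def g'_def hk)
  let ?I = "map_matrix of_int :: int mat6 \<Rightarrow> 'p padic mat6"
  have padic: "padic_mat (map_matrix of_int X) = ?I X" for X
    by (simp add: vec_eq_iff to_fract_of_int)
  have sig: "padic_mat (sigma u) = ?I (\<sigma> u)" for u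
    unfolding sigma_of_int padic \<sigma>_def ..
  have "(of_int ?p :: 'p padic) \<noteq> 0"
    using of_nat_card_padic_int_nonzero[where 'p='p] to_fract_eq_0_iff[of "of_nat CARD('p) :: 'p padic_int"]
    by (simp add: to_fract_of_nat)
  then have inv: "invertible (?I (\<sigma> t))"
    by (simp add: \<sigma>_def map_of_int_simps sigma_invertible)
  have "padic_mat (alpha \<Delta> g') = ?I (alpha \<Delta> g)"
    unfolding g'_def hk map_of_int_alpha[symmetric] padic ..
  then have "padic_mat (sigma s) ** padic_mat (alpha \<Delta> g') ** matrix_inv (padic_mat (sigma t))
      = ?I (\<sigma> s) ** ?I (alpha \<Delta> g) ** matrix_inv (?I (\<sigma> t))"
    by (simp only: sig)
  also have "\<dots> = ?I M ** (?I (\<sigma> t) ** matrix_inv (?I (\<sigma> t)))"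
    by (simp only: map_of_int_mult[symmetric] M[symmetric]) (simp only: map_of_int_mult matrix_mul_assoc)
  also have "\<dots> = padic_mat (map_matrix of_int M)"
    by (simp add: invertible_mult_matrix_inv[OF inv] padic)
  finally show ?thesis
    unfolding D_equivalent_def using g' GSp by (metis imageI)
qed

section \<open>Row vectors over the quadratic extension\<close>

text \<open>
  The vector \<open>(a + b \<delta>, c + d \<delta>, e + f \<delta>)\<close> of \<open>k\<^sup>3\<close>. The pair \<open>(x, y)\<close> stands for \<open>x + \<delta> y E\<close>,
  whence the sign of the last coordinate.
\<close>

definition qvec :: "'a::comm_ring_1 \<Rightarrow> 'a \<Rightarrow> 'a \<Rightarrow> 'a \<Rightarrow> 'a \<Rightarrow> 'a \<Rightarrow> 'a ^ (3 + 3)" where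
  "qvec a b c d e f = join (vector [a, c, e]) (vector [b, d, - f])"

lemma qvec_nth:
  "qvec a b c d e f $ Inl 1 = a" "qvec a b c d e f $ Inr 1 = b"
  "qvec a b c d e f $ Inl 2 = c" "qvec a b c d e f $ Inr 2 = d"
  "qvec a b c d e f $ Inl 3 = e" "qvec a b c d e f $ Inr 3 = - f"
  by (simp_all add: qvec_def join_def)

lemma qvec_exhaust: obtains a b c d e f where "v = qvec a b c d e f"
proof
  show "v = qvec (v $ Inl 1) (v $ Inr 1) (v $ Inl 2) (v $ Inr 2) (v $ Inl 3) (- v $ Inr 3)"
    by (simp add: vec_eq_iff split_sum_all forall_3 qvec_nth)
qed

lemma qvec_eq_iff:
  "qvec a b c d e f = qvec a' b' c' d' e' f' \<longleftrightarrow> a = a' \<and> b = b' \<and> c = c' \<and> d = d' \<and> e = e' \<and> f = f'"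
  by (auto simp: vec_eq_iff split_sum_all forall_3 qvec_nth)

lemma qvec_0: "(0 :: 'a::comm_ring_1 ^ (3 + 3)) = qvec 0 0 0 0 0 0"
  by (simp add: vec_eq_iff split_sum_all forall_3 qvec_nth)

lemma qvec_add: "qvec a b c d e f + qvec a' b' c' d' e' f' = qvec (a + a') (b + b') (c + c') (d + d') (e + e') (f + f')"
  by (simp add: vec_eq_iff split_sum_all forall_3 qvec_nth)

lemma qvec_diff: "qvec a b c d e f - qvec a' b' c' d' e' f' = qvec (a - a') (b - b') (c - c') (d - d') (e - e') (f - f')"
  by (simp add: vec_eq_iff split_sum_all forall_3 qvec_nth)

lemma qvec_scale: "t *s qvec a b c d e f = qvec (t * a) (t * b) (t * c) (t * d) (t * e) (t * f)"
  by (simp add: vec_eq_iff split_sum_all forall_3 qvec_nth)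

lemma sqrt_act_qvec:
  "sqrt_act \<Delta> (qvec a b c d e f) =
     qvec (- of_int \<Delta> * b) a (- of_int \<Delta> * d) c (- of_int \<Delta> * f) e"
  by (simp add: vec_eq_iff split_sum_all forall_3 qvec_nth sqrt_act_def join_def
      vector_matrix_mult_def sum_3 E21_def Let_def)

lemmas qvec_simps = qvec_eq_iff qvec_0 qvec_add qvec_diff qvec_scale sqrt_act_qvec

lemma qvec_mult_alpha:
  fixes h k :: "'a::comm_ring_1 mat3"
  shows "qvec a b c d e f v* alpha \<Delta> (h, k) =
     (let D = of_int \<Delta>;
          x = \<lambda>j. a * h$1$j + c * h$2$j + e * h$3$j - D * (b * k$1$j + d * k$2$j + f * k$3$j);
          y = \<lambda>j. a * k$1$j + c * k$2$j + e * k$3$j + (b * h$1$j + d * h$2$j + f * h$3$j)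
      in qvec (x 1) (y 1) (x 2) (y 2) (x 3) (y 3))"
  by (simp add: vec_eq_iff split_sum_all forall_3 qvec_nth Let_def alpha.simps qvec_def join_mult_block)
     (simp add: join_def vector_matrix_mult_def sum_3 matrix_matrix_mult_def E21_def mat_def algebra_simps)

lemma sqrt_act_linear: "Vector_Spaces.linear (*s) (*s) (sqrt_act \<Delta> :: 'a::field ^ (3 + 3) \<Rightarrow> _)"
proof unfold_locales
  fix u v :: "'a ^ (3 + 3)" and t :: 'a
  obtain a b c d e f where u: "u = qvec a b c d e f" by (rule qvec_exhaust)
  obtain a' b' c' d' e' f' where v: "v = qvec a' b' c' d' e' f'" by (rule qvec_exhaust)
  show "sqrt_act \<Delta> (u + v) = sqrt_act \<Delta> u + sqrt_act \<Delta> v"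
    by (simp add: u v qvec_simps algebra_simps)
  show "sqrt_act \<Delta> (t *s u) = t *s sqrt_act \<Delta> u"
    by (simp add: u qvec_simps algebra_simps)
qed

lemma sqrt_act_sqrt_act: "sqrt_act \<Delta> (sqrt_act \<Delta> v) = - of_int \<Delta> *s (v :: 'a::comm_ring_1 ^ (3 + 3))"
  by (cases v rule: qvec_exhaust) (simp add: qvec_simps)

definition symp_form :: "'a::comm_ring_1 ^ (3 + 3) \<Rightarrow> 'a ^ (3 + 3) \<Rightarrow> 'a" where
  "symp_form v w = (\<Sum>i\<in>UNIV. v $ Inl i * w $ Inr i - v $ Inr i * w $ Inl i)"

lemma symp_form_qvec:
  "symp_form (qvec a b c d e f) (qvec a' b' c' d' e' f') =
     a * b' - b * a' + (c * d' - d * c') - (e * f' - f * e')"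
  by (simp add: symp_form_def sum_3 qvec_nth algebra_simps)

lemma symp_form_W_sigma:
  assumes "transpose s = s" "v \<in> W_sigma s" "w \<in> (W_sigma s :: ('p::prime_card mod_ring ^ (3 + 3)) set)"
  shows "symp_form v w = 0"
proof -
  let ?S = "map_matrix of_int s :: 'p mod_ring mat3"
  have S: "s $ i $ j = s $ j $ i" for i j
    using arg_cong[OF assms(1), of "\<lambda>X. X $ i $ j"] by (simp add: transpose_def)
  obtain x y where "v = join x (x v* ?S)" "w = join y (y v* ?S)"
    using assms(2,3) unfolding W_sigma_graph by blast
  then show ?thesis
    using S[of 1 2] S[of 1 3] S[of 2 3]
    by (simp add: symp_form_def join_def vector_matrix_mult_def sum_3 algebra_simps)
qed

lemma dim_W_sigma: "vec.dim (W_sigma s :: ('p::prime_card mod_ring ^ (3 + 3)) set) = 3"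
proof -
  let ?f = "\<lambda>x. join x (x v* (map_matrix of_int s :: 'p mod_ring mat3))"
  have "Vector_Spaces.linear (*s) (*s) ?f"
    by unfold_locales (simp_all add: vec_eq_iff split_sum_all join_def vector_matrix_mult_def
        sum.distrib distrib_left sum_distrib_left mult_ac)
  moreover have "inj_on ?f (vec.span UNIV)"
    by (simp add: inj_on_def join_eq_iff)
  ultimately have "vec.dim (range ?f) = vec.dim (UNIV :: ('p mod_ring ^ 3) set)"
    by (rule vec.dim_image_eq)
  moreover have "range ?f = W_sigma s" unfolding W_sigma_graph by auto
  ultimately show ?thesis by (simp add: vec.dim_UNIV card_cart_basis)
qed

text \<open>
  The span over the quadratic extension contains \<open>W + \<delta> W\<close>, a sum of two spaces of dimension
  3. If its dimension is less than 6, then some \<open>\<delta> y\<close> with \<open>y\<close> in \<open>W\<close> is a nonzero element of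
  \<open>W\<close>.
\<close>

lemma exists_sqrt_stable_vector:
  fixes s :: "int mat3"
  defines "W \<equiv> W_sigma s :: ('p::prime_card mod_ring ^ (3 + 3)) set"
  assumes \<Delta>: "(of_int \<Delta> :: 'p mod_ring) \<noteq> 0" and dim: "vec.dim (quad_span \<Delta> W) < 6"
  obtains w where "w \<in> W" "w \<noteq> 0" "sqrt_act \<Delta> w \<in> W"
proof -
  let ?T = "sqrt_act \<Delta> :: 'p mod_ring ^ (3 + 3) \<Rightarrow> _"
  have sub: "vec.subspace W" by (simp add: W_def W_sigma_def)
  have inj: "inj ?T"
    using \<Delta> by (intro injI) (metis sqrt_act_sqrt_act vec.scale_cancel_left neg_equal_0_iff_equal)
  have subT: "vec.subspace (?T ` W)"
    using vec.linear_subspace_image[OF sqrt_act_linear sub] .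
  have "vec.dim (?T ` W) = 3"
    using vec.dim_image_eq[OF sqrt_act_linear inj_on_subset[OF inj subset_UNIV], of W]
    by (simp add: dim_W_sigma W_def)
  then have "vec.dim {x + y | x y. x \<in> W \<and> y \<in> ?T ` W} + vec.dim (W \<inter> ?T ` W) = 6"
    using vec.dim_sums_Int[OF sub subT] by (simp add: dim_W_sigma W_def)
  moreover have "{x + y | x y. x \<in> W \<and> y \<in> ?T ` W} \<subseteq> quad_span \<Delta> W"
  proof safe
    fix x y assume x: "x \<in> W" and y: "y \<in> W"
    have "x = 1 *s x + 0 *s ?T x" "?T y = 0 *s y + 1 *s ?T y" by simp_all
    then have "x \<in> {a *s w + b *s ?T w | a b w. w \<in> W}"
        "?T y \<in> {a *s w + b *s ?T w | a b w. w \<in> W}"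
      using x y by blast+
    then show "x + ?T y \<in> quad_span \<Delta> W"
      unfolding quad_span_def by (intro vec.span_add vec.span_base)
  qed
  from vec.dim_subset[OF this] have "vec.dim {x + y | x y. x \<in> W \<and> y \<in> ?T ` W} < 6"
    using dim by (rule le_less_trans)
  ultimately have "vec.dim (W \<inter> ?T ` W) \<noteq> 0" by linarith
  then have "\<not> W \<inter> ?T ` W \<subseteq> {0}" by (simp add: vec.dim_eq_0)
  then obtain y where y: "y \<in> W" "?T y \<in> W" "?T y \<noteq> 0" by blast
  moreover have "y \<noteq> 0" using y(3) by (auto simp: qvec_simps)
  ultimately show ?thesis using that by blast
qed

section \<open>Explicit similitudes with integer parameters\<close>

text \<open>
  With \<open>z = a + b \<delta>\<close>, \<open>\<kappa> = q + r \<delta>\<close>, this is the matrix with rows \<open>(1, -2 z', 2 z')\<close>,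
  \<open>(2 z, 1 + \<kappa>, -\<kappa>)\<close>, \<open>(2 z, \<kappa>, 1 - \<kappa>)\<close>, where \<open>z'\<close> is the conjugate of \<open>z\<close>, times the
  reflection \<open>diag(1, 1, \<epsilon>)\<close>. It is unitary when \<open>q = -2 N(z)\<close>. Over a field of odd
  characteristic, these unitary matrices with \<open>\<epsilon> = 1\<close> form the unipotent radical of the
  stabilizer of the isotropic line through \<open>(0, 1, -1)\<close>. The parameter is \<open>2 z\<close>, not \<open>z\<close>,
  because the real part of \<open>\<kappa>\<close> is minus half the norm of the parameter and has to be an
  integer.
\<close>

definition unip :: "int \<Rightarrow> int \<Rightarrow> int \<Rightarrow> int \<Rightarrow> int \<Rightarrow> int qmat3" where
  "unip \<epsilon> a b q r =
     (vector [vector [1, - 2 * a, 2 * \<epsilon> * a],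
              vector [2 * a, 1 + q, - \<epsilon> * q],
              vector [2 * a, q, \<epsilon> * (1 - q)]],
      vector [vector [0, 2 * b, - 2 * \<epsilon> * b],
              vector [2 * b, r, - \<epsilon> * r],
              vector [2 * b, r, - \<epsilon> * r]])"

text \<open>
  The adjoint \<open>E g\<^sup>* E\<close> of \<open>g = unip \<epsilon> a b q r\<close>, which is the inverse of a unitary matrix.
\<close>

definition unip_inv :: "int \<Rightarrow> int \<Rightarrow> int \<Rightarrow> int \<Rightarrow> int \<Rightarrow> int qmat3" where
  "unip_inv \<epsilon> a b q r =
     (vector [vector [1, 2 * a, - 2 * a],
              vector [- 2 * a, 1 + q, - q],
              vector [- 2 * \<epsilon> * a, \<epsilon> * q, \<epsilon> * (1 - q)]],
      vector [vector [0, - 2 * b, 2 * b],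
              vector [- 2 * b, - r, r],
              vector [- 2 * \<epsilon> * b, - \<epsilon> * r, \<epsilon> * r]])"

definition scal :: "int \<Rightarrow> int \<Rightarrow> int qmat3" where
  "scal a b = (mat a, mat b)"

lemmas mat3_simps = vec_eq_iff forall_3 sum_3 matrix_matrix_mult_def mat_def transpose_def E21_def

lemma similitude_unip:
  assumes "\<epsilon> = 1 \<or> \<epsilon> = -1" "q = - 2 * (a * a + \<Delta> * (b * b))"
  shows "similitude \<Delta> 1 (unip \<epsilon> a b q r)"
  unfolding unip_def similitude_iff assms(2)
  using assms(1) by (auto simp: mat3_simps algebra_simps)

lemma similitude_unip_inv:
  assumes "\<epsilon> = 1 \<or> \<epsilon> = -1" "q = - 2 * (a * a + \<Delta> * (b * b))"
  shows "similitude \<Delta> 1 (unip_inv \<epsilon> a b q r)"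
  unfolding unip_inv_def similitude_iff assms(2)
  using assms(1) by (auto simp: mat3_simps algebra_simps)

lemma unip_mult_unip_inv:
  assumes "\<epsilon> = 1 \<or> \<epsilon> = -1" "q = - 2 * (a * a + \<Delta> * (b * b))"
  shows "qmult \<Delta> (unip \<epsilon> a b q r) (unip_inv \<epsilon> a b q r) = (mat 1, 0)"
  unfolding unip_def unip_inv_def qmult_def assms(2)
  using assms(1) by (auto simp: mat3_simps algebra_simps)

lemma similitude_scal: "similitude \<Delta> (a * a + \<Delta> * (b * b)) (scal a b)"
  unfolding scal_def similitude_iff by (auto simp: mat3_simps algebra_simps)

lemma qvec_mult_scal:
  "qvec x1 x2 y1 y2 z1 z2 v* map_matrix of_int (alpha \<Delta> (scal a b)) =
     (let A = of_int a; B = of_int b; D = of_int \<Delta> in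
       qvec (x1 * A - D * x2 * B) (x1 * B + x2 * A) (y1 * A - D * y2 * B) (y1 * B + y2 * A)
         (z1 * A - D * z2 * B) (z1 * B + z2 * A :: 'a::comm_ring_1))"
  by (simp add: scal_def map_of_int_alpha qvec_mult_alpha Let_def mat_def qvec_eq_iff del: alpha.simps)

text \<open>
  The vector \<open>x (1, 0, 0) + m (0, 1, 1)\<close> goes to \<open>m w + x u\<close>, where
  \<open>w = (4 z, 1 + 2 \<kappa>, \<epsilon> (1 - 2 \<kappa>))\<close> is the sum of the last two rows and \<open>u\<close> is the first row.
\<close>

lemma qvec_mult_unip:
  "qvec x1 x2 m1 m2 m1 m2 v* map_matrix of_int (alpha \<Delta> (unip \<epsilon> a b q r)) =
     (let A = of_int a; B = of_int b; D = of_int \<Delta>; Q = of_int q; R = of_int r; E = of_int \<epsilon>;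
          w = qvec (4 * A) (4 * B) (1 + 2 * Q) (2 * R) (E * (1 - 2 * Q)) (- (E * (2 * R)));
          u1 = - 2 * (x1 * A + D * x2 * B); u2 = - 2 * (x2 * A - x1 * B)
      in m1 *s w + m2 *s sqrt_act \<Delta> w + qvec x1 x2 u1 u2 (- (E * u1)) (- (E * u2 :: 'a::comm_ring_1)))"
  by (simp add: unip_def map_of_int_alpha qvec_mult_alpha Let_def qvec_simps algebra_simps del: alpha.simps)

section \<open>A normal form for the Lagrangian subspaces\<close>

text \<open>
  The subspace \<open>k (0, 1, 1) + F c (1, 0, 0)\<close> for \<open>c = c1 + c2 \<delta>\<close>.
\<close>

definition W_std :: "'a::comm_ring_1 \<Rightarrow> 'a \<Rightarrow> ('a ^ (3 + 3)) set" where
  "W_std c1 c2 = {qvec (e * c1) (e * c2) m n m n | e m n. True}"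

text \<open>
  Here \<open>w'\<close> is the image of \<open>(0, 1, 1)\<close>, and \<open>u\<close> that of \<open>c (1, 0, 0)\<close>, under the matrix
  \<open>unip\<close> with parameters \<open>\<epsilon>\<close>, \<open>z\<close>, \<open>\<kappa>\<close>. The line \<open>k w\<close> is isotropic and \<open>N\<close> is anisotropic, so
  for one choice of the sign \<open>\<epsilon>\<close> the scalar \<open>w\<^sub>2 + \<epsilon> w\<^sub>3\<close> is invertible in \<open>k\<close>; scaling it to 2
  gives \<open>w'\<close> the required shape, with \<open>z\<close> and \<open>\<kappa>\<close> read off from its coordinates, and isotropy
  of \<open>w'\<close> is the equation \<open>q = -2 N(z)\<close>. Subtracting a multiple of \<open>w'\<close> from a vector of \<open>W\<close>
  outside \<open>k w'\<close> gives \<open>u\<close> with \<open>u\<^sub>2 + \<epsilon> u\<^sub>3 = 0\<close>, and orthogonality to \<open>w'\<close> determines \<open>u\<^sub>2\<close>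
  from \<open>c = u\<^sub>1\<close>. Then \<open>c \<noteq> 0\<close>, since \<open>u\<close> would vanish otherwise.
\<close>

lemma lagrangian_normal_form:
  fixes W :: "('a::field ^ (3 + 3)) set" and \<Delta> :: int
  defines "D \<equiv> (of_int \<Delta> :: 'a)" and "T \<equiv> sqrt_act \<Delta> :: 'a ^ (3 + 3) \<Rightarrow> _"
  assumes nonsq: "\<And>t :: 'a. t * t + D \<noteq> 0" and two: "(2 :: 'a) \<noteq> 0"
    and sub: "vec.subspace W" and dim: "vec.dim W = 3"
    and iso: "\<And>v w. v \<in> W \<Longrightarrow> w \<in> W \<Longrightarrow> symp_form v w = 0"
    and w: "w \<in> W" "w \<noteq> 0" "T w \<in> W"
  obtains \<epsilon> z1 z2 q r c1 c2 w' u where "\<epsilon> = 1 \<or> \<epsilon> = -1" "q = - 2 * (z1 * z1 + D * (z2 * z2))"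
    "c1 \<noteq> 0 \<or> c2 \<noteq> 0"
    "w' = qvec (4 * z1) (4 * z2) (1 + 2 * q) (2 * r) (\<epsilon> * (1 - 2 * q)) (- (\<epsilon> * (2 * r)))"
    "u = qvec c1 c2 (- 2 * (c1 * z1 + D * c2 * z2)) (- 2 * (c2 * z1 - c1 * z2))
      (- (\<epsilon> * (- 2 * (c1 * z1 + D * c2 * z2)))) (- (\<epsilon> * (- 2 * (c2 * z1 - c1 * z2))))"
    "W = {m *s w' + n *s T w' + e *s u | m n e. True}"
proof -
  have aniso: "a = 0 \<and> b = 0" if "a * a + D * (b * b) = 0" for a b :: 'a
  proof -
    have "b = 0"
    proof (rule ccontr)
      assume "b \<noteq> 0"
      then have "a / b * (a / b) + D = (a * a + D * (b * b)) / (b * b)"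
        by (simp add: field_simps)
      then show False using that nonsq[of "a / b"] by simp
    qed
    then show ?thesis using that by simp
  qed
  obtain a1 b1 a2 b2 a3 b3 where w_eq: "w = qvec a1 b1 a2 b2 a3 b3" by (rule qvec_exhaust)
  have norm_w: "a1 * a1 + D * (b1 * b1) + (a2 * a2 + D * (b2 * b2)) - (a3 * a3 + D * (b3 * b3)) = 0"
    using iso[OF w(1,3)] by (simp add: w_eq T_def D_def sqrt_act_qvec symp_form_qvec algebra_simps)
  have "\<exists>\<epsilon>. (\<epsilon> = 1 \<or> \<epsilon> = -1) \<and> (a2 + \<epsilon> * a3 \<noteq> 0 \<or> b2 + \<epsilon> * b3 \<noteq> 0)"
  proof (rule ccontr)
    assume "\<not> ?thesis"
    then have pm: "a2 + a3 = 0" "a2 - a3 = 0" "b2 + b3 = 0" "b2 - b3 = 0"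
      by (auto dest: spec[of _ 1] spec[of _ "-1"])
    have "2 * a2 = (a2 + a3) + (a2 - a3)" "2 * b2 = (b2 + b3) + (b2 - b3)" by simp_all
    then have "2 * a2 = 0" "2 * b2 = 0" unfolding pm by simp_all
    then have "a2 = 0" "b2 = 0" using two by simp_all
    with pm have *: "a2 = 0" "a3 = 0" "b2 = 0" "b3 = 0" by simp_all
    then have "a1 = 0 \<and> b1 = 0" using norm_w by (intro aniso) simp
    with * w(2) show False by (simp add: w_eq qvec_simps)
  qed
  then obtain \<epsilon> where \<epsilon>: "\<epsilon> = 1 \<or> \<epsilon> = -1" and mn: "a2 + \<epsilon> * a3 \<noteq> 0 \<or> b2 + \<epsilon> * b3 \<noteq> 0"
    by blast
  define m n where "m = a2 + \<epsilon> * a3" and "n = b2 + \<epsilon> * b3"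
  define N where "N = m * m + D * (n * n)"
  have "m \<noteq> 0 \<or> n \<noteq> 0" using mn by (simp only: m_def n_def)
  then have N: "N \<noteq> 0" using aniso[of m n] unfolding N_def by blast
  \<comment> \<open>The scalar \<open>x - y \<delta>\<close> is \<open>2 / (m + n \<delta>)\<close>.\<close>
  define x y where "x = 2 * m / N" and "y = 2 * n / N"
  define w' where "w' = x *s w + (- y) *s T w"
  have T_w': "T w' = (D * y) *s w + x *s T w"
    by (simp add: w'_def w_eq T_def D_def qvec_simps algebra_simps)
  have "w' \<in> W"
    unfolding w'_def by (intro vec.subspace_add vec.subspace_scale sub w)
  moreover have "T w' \<in> W"
    unfolding T_w' by (intro vec.subspace_add vec.subspace_scale sub w)
  ultimately have w'_W: "w' \<in> W" "T w' \<in> W" .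
  obtain A1 B1 A2 B2 A3 B3 where w'_eq: "w' = qvec A1 B1 A2 B2 A3 B3" by (rule qvec_exhaust)
  have A: "A2 + \<epsilon> * A3 = 2" and B: "B2 + \<epsilon> * B3 = 0"
  proof -
    have e: "A2 = x * a2 + y * (D * b2)" "A3 = x * a3 + y * (D * b3)"
        "B2 = x * b2 - y * a2" "B3 = x * b3 - y * a3"
      using w'_eq by (simp_all add: w'_def w_eq T_def D_def qvec_simps algebra_simps)
    have "A2 + \<epsilon> * A3 = x * m + y * (D * n)"
      unfolding e m_def n_def by (simp add: algebra_simps)
    also have "\<dots> = (2 * m * m + 2 * n * (D * n)) / N"
      by (simp add: x_def y_def add_divide_distrib)
    also have "2 * m * m + 2 * n * (D * n) = 2 * N" by (simp add: N_def algebra_simps)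
    finally show "A2 + \<epsilon> * A3 = 2" using N by simp
    have "B2 + \<epsilon> * B3 = x * n - y * m"
      unfolding e m_def n_def by (simp add: algebra_simps)
    then show "B2 + \<epsilon> * B3 = 0" by (simp add: x_def y_def mult_ac)
  qed
  define z1 z2 q r where "z1 = A1 / 4" and "z2 = B1 / 4" and "q = (A2 - 1) / 2" and "r = B2 / 2"
  have four: "(4 :: 'a) \<noteq> 0" using no_zero_divisors[OF two two] by simp
  have eqs: "A1 = 4 * z1" "B1 = 4 * z2" "A2 = 1 + 2 * q" "B2 = 2 * r"
  proof -
    have "4 * z1 = A1" "4 * z2 = B1" "2 * q = A2 - 1" "2 * r = B2"
      unfolding z1_def z2_def q_def r_def times_divide_eq_right
      by (rule nonzero_mult_div_cancel_left[OF four] nonzero_mult_div_cancel_left[OF two])+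
    then show "A1 = 4 * z1" "B1 = 4 * z2" "A2 = 1 + 2 * q" "B2 = 2 * r" by simp_all
  qed
  have "A3 = \<epsilon> * (A2 + \<epsilon> * A3 - A2)" "B3 = \<epsilon> * (B2 + \<epsilon> * B3 - B2)"
    using \<epsilon> by auto
  then have "A3 = \<epsilon> * (2 - A2)" "B3 = \<epsilon> * (0 - B2)"
    unfolding A B .
  then have eqs3: "A3 = \<epsilon> * (1 - 2 * q)" "B3 = - (\<epsilon> * (2 * r))"
    by (simp_all add: eqs)
  have w'_form: "w' = qvec (4 * z1) (4 * z2) (1 + 2 * q) (2 * r) (\<epsilon> * (1 - 2 * q)) (- (\<epsilon> * (2 * r)))"
    by (simp add: w'_eq eqs eqs3)
  have q: "q = - 2 * (z1 * z1 + D * (z2 * z2))"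
  proof -
    have "symp_form w' (T w') = 0" using iso w'_W by blast
    then have "8 * (q + 2 * (z1 * z1 + D * (z2 * z2))) = 0"
      using \<epsilon> by (auto simp: w'_form T_def D_def sqrt_act_qvec symp_form_qvec algebra_simps)
    moreover have "(8 :: 'a) \<noteq> 0" using no_zero_divisors[OF two four] by simp
    ultimately have "q + 2 * (z1 * z1 + D * (z2 * z2)) = 0" by (simp only: mult_eq_0_iff) blast
    then show ?thesis by (simp only: eq_neg_iff_add_eq_0 mult_minus_left)
  qed
  have w'0: "w' \<noteq> 0"
    using A two by (auto simp: w'_eq qvec_simps)
  have "\<not> W \<subseteq> vec.span {w', T w'}"
  proof
    assume "W \<subseteq> vec.span {w', T w'}"
    then have "vec.dim W \<le> card {w', T w'}" by (rule vec.dim_le_card) simp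
    also have "\<dots> \<le> 2" by (simp add: card_insert_if)
    finally show False using dim by simp
  qed
  then obtain v where v: "v \<in> W" "v \<notin> vec.span {w', T w'}" by blast
  obtain v1 y1 v2 y2 v3 y3 where v_eq: "v = qvec v1 y1 v2 y2 v3 y3" by (rule qvec_exhaust)
  \<comment> \<open>Since \<open>w'\<^sub>2 + \<epsilon> w'\<^sub>3 = 2\<close>, subtracting \<open>(X + Y \<delta>) w'\<close> makes \<open>u\<^sub>2 + \<epsilon> u\<^sub>3\<close> vanish.\<close>
  define X Y where "X = (v2 + \<epsilon> * v3) / 2" and "Y = (y2 + \<epsilon> * y3) / 2"
  have XY: "v2 + \<epsilon> * v3 = 2 * X" "y2 + \<epsilon> * y3 = 2 * Y"
    unfolding X_def Y_def times_divide_eq_right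
    by (rule nonzero_mult_div_cancel_left[OF two, symmetric])+
  define u where "u = v - (X *s w' + Y *s T w')"
  have u_W: "u \<in> W"
    unfolding u_def using v(1) w'_W sub by (intro vec.subspace_diff vec.subspace_add vec.subspace_scale)
  have span_w': "X *s w' + Y *s T w' \<in> vec.span {w', T w'}"
    by (intro vec.span_add vec.span_scale vec.span_base) auto
  have u_span: "u \<notin> vec.span {w', T w'}"
    using v(2) vec.span_add[OF _ span_w', of u] by (auto simp: u_def)
  obtain c1 c2 f1 f2 g1 g2 where u_eq: "u = qvec c1 c2 f1 f2 g1 g2" by (rule qvec_exhaust)
  have g: "g1 = - (\<epsilon> * f1)" "g2 = - (\<epsilon> * f2)"
  proof -
    have e: "f1 = v2 - (X * A2 - Y * (D * B2))" "g1 = v3 - (X * A3 - Y * (D * B3))"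
        "f2 = y2 - (X * B2 + Y * A2)" "g2 = y3 - (X * B3 + Y * A3)"
      using u_eq by (simp_all add: u_def v_eq w'_eq T_def D_def qvec_simps)
    have "f1 + \<epsilon> * g1 = (v2 + \<epsilon> * v3) - (X * (A2 + \<epsilon> * A3) - Y * (D * (B2 + \<epsilon> * B3)))"
         "f2 + \<epsilon> * g2 = (y2 + \<epsilon> * y3) - (X * (B2 + \<epsilon> * B3) + Y * (A2 + \<epsilon> * A3))"
      unfolding e by (simp_all add: algebra_simps)
    then have fg: "f1 + \<epsilon> * g1 = 0" "f2 + \<epsilon> * g2 = 0" by (simp_all add: A B XY)
    have "g1 = \<epsilon> * (f1 + \<epsilon> * g1) - \<epsilon> * f1" using \<epsilon> by auto
    also have "\<dots> = - (\<epsilon> * f1)" by (simp add: fg(1))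
    finally show "g1 = - (\<epsilon> * f1)" .
    have "g2 = \<epsilon> * (f2 + \<epsilon> * g2) - \<epsilon> * f2" using \<epsilon> by auto
    also have "\<dots> = - (\<epsilon> * f2)" by (simp add: fg(2))
    finally show "g2 = - (\<epsilon> * f2)" .
  qed
  have f: "f1 = - 2 * (c1 * z1 + D * c2 * z2)" "f2 = - 2 * (c2 * z1 - c1 * z2)"
  proof -
    have "symp_form u w' = 0" "symp_form u (T w') = 0" using iso u_W w'_W by blast+
    then have "2 * (f2 + 2 * (c2 * z1 - c1 * z2)) = 0" "2 * (f1 + 2 * (c1 * z1 + D * c2 * z2)) = 0"
      using \<epsilon> by (auto simp: w'_form u_eq g T_def D_def sqrt_act_qvec symp_form_qvec algebra_simps)
    then have "f2 + 2 * (c2 * z1 - c1 * z2) = 0" "f1 + 2 * (c1 * z1 + D * c2 * z2) = 0"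
      using two by (simp_all only: mult_eq_0_iff) blast+
    then show "f1 = - 2 * (c1 * z1 + D * c2 * z2)" "f2 = - 2 * (c2 * z1 - c1 * z2)"
      by (simp_all only: eq_neg_iff_add_eq_0 mult_minus_left)
  qed
  have c: "c1 \<noteq> 0 \<or> c2 \<noteq> 0"
  proof (rule ccontr)
    assume "\<not> ?thesis"
    then have "u = 0" by (simp add: u_eq g f qvec_0)
    then show False using u_span by (simp add: vec.span_zero)
  qed
  \<comment> \<open>An eigenvalue \<open>t\<close> of the action of \<open>\<delta>\<close> would satisfy \<open>t\<^sup>2 = -\<Delta>\<close>.\<close>
  have "T w' \<notin> vec.span {w'}"
  proof
    assume "T w' \<in> vec.span {w'}"
    then obtain t where t: "T w' = t *s w'" by (auto simp: vec.span_singleton)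
    have "- D *s w' = T (T w')" by (simp add: T_def D_def sqrt_act_sqrt_act)
    also have "T (T w') = T (t *s w')" by (simp only: t)
    also have "\<dots> = t *s T w'"
      unfolding T_def by (rule vec.linear_scale[OF sqrt_act_linear])
    also have "\<dots> = (t * t) *s w'" by (simp add: t)
    finally have "- D = t * t" using w'0 vec.scale_cancel_right[of "- D" w' "t * t"] by simp
    then show False using nonsq[of t] by (simp flip: \<open>- D = t * t\<close>)
  qed
  then have "vec.independent {u, T w', w'}"
    using u_span w'0 by (intro vec.independent_insertI) (auto simp: insert_commute vec.independent_empty)
  moreover have "card {u, T w', w'} = 3"
    using u_span \<open>T w' \<notin> vec.span {w'}\<close> vec.span_base[of _ "{w', T w'}"] vec.span_base[of _ "{w'}"]
    by (auto simp: card_insert_if)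
  ultimately have W_span: "W \<subseteq> vec.span {u, T w', w'}"
    using w'_W u_W by (intro vec.card_ge_dim_independent) (auto simp: dim)
  have "W = {m *s w' + n *s T w' + e *s u | m n e. True}"
  proof
    show "W \<subseteq> {m *s w' + n *s T w' + e *s u | m n e. True}"
    proof
      fix x assume "x \<in> W"
      then have "x \<in> vec.span {u, T w', w'}" using W_span by blast
      then obtain e n m where "x - e *s u - n *s T w' = m *s w'"
        unfolding vec.span_breakdown_eq[of _ u] vec.span_breakdown_eq[of _ "T w'"] vec.span_singleton by blast
      then have "x = m *s w' + n *s T w' + e *s u" by (simp only: diff_eq_eq)
      then show "x \<in> {m *s w' + n *s T w' + e *s u | m n e. True}" by blast
    qed
    show "{m *s w' + n *s T w' + e *s u | m n e. True} \<subseteq> W"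
      using w'_W u_W sub by (auto intro!: vec.subspace_add vec.subspace_scale)
  qed
  then show ?thesis
    by (rule that[OF \<epsilon> q c w'_form u_eq[unfolded g f]])
qed

section \<open>Moving every subspace to the standard one\<close>

text \<open>
  The similitude is taken over the integers because it has to act both on \<open>F\<^sub>p\<^sup>6\<close> and, as an
  element of \<open>G_V\<close>, over \<open>\<int>\<^sub>p\<close>; the condition on the multiplier makes it invertible there.
\<close>

definition carries ::
  "int \<Rightarrow> ('p::prime_card mod_ring ^ (3 + 3)) set \<Rightarrow> ('p mod_ring ^ (3 + 3)) set \<Rightarrow> bool" where
  "carries \<Delta> U V \<longleftrightarrow> (\<exists>g c. similitude \<Delta> c g \<and> \<not> int CARD('p) dvd c \<and>
     (\<forall>v\<in>U. v v* map_matrix of_int (alpha \<Delta> g) \<in> V))"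

lemma carriesI:
  assumes "similitude \<Delta> c g" "\<not> int CARD('p) dvd c"
    and "\<And>v :: 'p::prime_card mod_ring ^ (3 + 3). v \<in> U \<Longrightarrow> v v* map_matrix of_int (alpha \<Delta> g) \<in> V"
  shows "carries \<Delta> U V"
  using assms unfolding carries_def by blast

lemma carries_trans:
  fixes U V W :: "('p::prime_card mod_ring ^ (3 + 3)) set"
  assumes "carries \<Delta> U V" "carries \<Delta> V W"
  shows "carries \<Delta> U W"
proof -
  obtain g c g' c' where g: "similitude \<Delta> c g" "\<not> int CARD('p) dvd c"
      "\<And>v. v \<in> U \<Longrightarrow> v v* map_matrix of_int (alpha \<Delta> g) \<in> V"
    and g': "similitude \<Delta> c' g'" "\<not> int CARD('p) dvd c'"
      "\<And>v. v \<in> V \<Longrightarrow> v v* map_matrix of_int (alpha \<Delta> g') \<in> W"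
    using assms unfolding carries_def by blast
  show ?thesis
  proof (rule carriesI)
    show "similitude \<Delta> (c * c') (qmult \<Delta> g g')" by (rule similitude_qmult[OF g(1) g'(1)])
    show "\<not> int CARD('p) dvd c * c'"
      using g(2) g'(2) padic_prime[where 'p='p] by (simp add: prime_dvd_mult_iff)
    show "v v* map_matrix of_int (alpha \<Delta> (qmult \<Delta> g g')) \<in> W" if "v \<in> U" for v
      using g'(3)[OF g(3)[OF that]] unfolding alpha_qmult map_of_int_mult vector_matrix_mul_assoc .
  qed
qed

lemma obtain_int_of_mod_ring:
  obtains n :: int where "x = (of_int n :: 'p::prime_card mod_ring)"
  using surj_of_nat_mod_ring[of x] by (metis of_int_of_nat_eq)

text \<open>
  The matrices of the normal form and their inverses give both directions. A scalar matrix \<open>c\<close>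
  is undone by its conjugate, up to the factor \<open>N(c)\<close> in \<open>F\<^sub>p\<close>, which preserves every subspace;
  \<open>N(c)\<close> is prime to \<open>p\<close> because the norm is anisotropic.
\<close>

lemma W_sigma_carries:
  fixes s :: "int mat3"
  defines "W \<equiv> W_sigma s :: ('p::prime_card mod_ring ^ (3 + 3)) set"
  assumes odd: "odd CARD('p)" and inert: "\<And>a. \<not> int CARD('p) dvd a\<^sup>2 + \<Delta>"
    and sym: "transpose s = s" and dim: "vec.dim (quad_span \<Delta> W) = 4"
  shows "carries \<Delta> W (W_std 1 0)" "carries \<Delta> (W_std 1 0) W"
proof -
  let ?F = "of_int :: int \<Rightarrow> 'p mod_ring"
  have nonsq: "t * t + ?F \<Delta> \<noteq> 0" for t
  proof -
    obtain n where "t = ?F n" by (rule obtain_int_of_mod_ring)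
    then have "t * t + ?F \<Delta> = ?F (n\<^sup>2 + \<Delta>)" by (simp add: power2_eq_square)
    then show ?thesis using inert[of n] by (simp only: of_int_mod_ring_eq_0_iff) simp
  qed
  have two: "(2 :: 'p mod_ring) \<noteq> 0"
  proof
    assume "(2 :: 'p mod_ring) = 0"
    then have "?F 2 = 0" by simp
    then have "int CARD('p) dvd 2" by (simp only: of_int_mod_ring_eq_0_iff)
    then have "CARD('p) dvd 2" by presburger
    then have "CARD('p) \<le> 2" by (rule dvd_imp_le) simp
    moreover have "CARD('p) > 1" using prime_card[where 'a='p] by (rule prime_gt_1_nat)
    ultimately show False using odd by (cases "CARD('p) = 2") auto
  qed
  have \<Delta>0: "?F \<Delta> \<noteq> 0" using nonsq[of 0] by simp
  have "vec.dim (quad_span \<Delta> W) < 6" by (simp add: dim)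
  then obtain w where w: "w \<in> W" "w \<noteq> 0" "sqrt_act \<Delta> w \<in> W"
    unfolding W_def by (rule exists_sqrt_stable_vector[OF \<Delta>0])
  have sub: "vec.subspace W" by (simp add: W_def W_sigma_def)
  have dim3: "vec.dim W = 3" by (simp add: W_def dim_W_sigma)
  have iso: "symp_form v v' = 0" if "v \<in> W" "v' \<in> W" for v v'
    using that sym symp_form_W_sigma unfolding W_def by blast
  obtain \<epsilon> z1 z2 q r c1 c2 w' u where \<epsilon>: "\<epsilon> = 1 \<or> \<epsilon> = -1"
    and q: "q = - 2 * (z1 * z1 + ?F \<Delta> * (z2 * z2))" and c: "c1 \<noteq> 0 \<or> c2 \<noteq> 0"
    and w': "w' = qvec (4 * z1) (4 * z2) (1 + 2 * q) (2 * r) (\<epsilon> * (1 - 2 * q)) (- (\<epsilon> * (2 * r)))"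
    and u: "u = qvec c1 c2 (- 2 * (c1 * z1 + ?F \<Delta> * c2 * z2)) (- 2 * (c2 * z1 - c1 * z2))
      (- (\<epsilon> * (- 2 * (c1 * z1 + ?F \<Delta> * c2 * z2)))) (- (\<epsilon> * (- 2 * (c2 * z1 - c1 * z2))))"
    and W: "W = {m *s w' + n *s sqrt_act \<Delta> w' + e *s u | m n e. True}"
    by (rule lagrangian_normal_form[OF nonsq two sub dim3 iso w])
  obtain a where a: "z1 = ?F a" by (rule obtain_int_of_mod_ring)
  obtain b where b: "z2 = ?F b" by (rule obtain_int_of_mod_ring)
  obtain R where R: "r = ?F R" by (rule obtain_int_of_mod_ring)
  obtain C1 where C1: "c1 = ?F C1" by (rule obtain_int_of_mod_ring)
  obtain C2 where C2: "c2 = ?F C2" by (rule obtain_int_of_mod_ring)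
  note lift = a b R C1 C2
  define e' :: int where "e' = (if \<epsilon> = 1 then 1 else -1)"
  have e': "e' = 1 \<or> e' = -1" "\<epsilon> = ?F e'" using \<epsilon> by (auto simp: e'_def)
  define Q where "Q = - 2 * (a * a + \<Delta> * (b * b))"
  have Q: "q = ?F Q" by (simp add: q Q_def lift)
  let ?g = "unip e' a b Q R" and ?g' = "unip_inv e' a b Q R"
  have act: "qvec (e * c1) (e * c2) m n m n v* map_matrix of_int (alpha \<Delta> ?g)
      = m *s w' + n *s sqrt_act \<Delta> w' + e *s u" for e m n
    unfolding qvec_mult_unip w' u by (simp add: Let_def lift e'(2) Q qvec_simps algebra_simps)
  have one: "\<not> int CARD('p) dvd 1"
    using prime_gt_1_nat[OF prime_card[where 'a='p]] by simp
  have std_W: "carries \<Delta> (W_std c1 c2) W"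
    by (rule carriesI[OF similitude_unip[OF e'(1) Q_def, of R] one])
      (unfold W_std_def W, use act in blast)
  have W_std: "carries \<Delta> W (W_std c1 c2)"
  proof (rule carriesI[OF similitude_unip_inv[OF e'(1) Q_def, of R] one])
    fix v assume "v \<in> W"
    then obtain e m n where v: "v = qvec (e * c1) (e * c2) m n m n v* map_matrix of_int (alpha \<Delta> ?g)"
      unfolding W act by blast
    have "alpha \<Delta> ?g ** alpha \<Delta> ?g' = mat 1"
      unfolding alpha_qmult[symmetric] unip_mult_unip_inv[OF e'(1) Q_def]
      by (simp add: E21_mult_E21 mat_block[of 1] matrix_mult_zero_left matrix_mult_zero_right)
    then have "map_matrix of_int (alpha \<Delta> ?g) ** map_matrix of_int (alpha \<Delta> ?g') = (mat 1 :: 'p mod_ring mat6)"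
      by (simp only: map_of_int_mult[symmetric] map_of_int_mat of_int_1)
    then have "v v* map_matrix of_int (alpha \<Delta> ?g') = qvec (e * c1) (e * c2) m n m n"
      unfolding v vector_matrix_mul_assoc by simp
    then show "v v* map_matrix of_int (alpha \<Delta> ?g') \<in> W_std c1 c2"
      by (auto simp: W_std_def)
  qed
  have norm: "\<not> int CARD('p) dvd C1 * C1 + \<Delta> * (C2 * C2)"
  proof
    assume "int CARD('p) dvd C1 * C1 + \<Delta> * (C2 * C2)"
    then have "?F (C1 * C1 + \<Delta> * (C2 * C2)) = 0" by (simp only: of_int_mod_ring_eq_0_iff)
    then have N: "c1 * c1 + ?F \<Delta> * (c2 * c2) = 0" by (simp add: lift)
    show False
    proof (cases "c2 = 0")
      case True
      with N c show False by simp
    next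
      case False
      then have "c1 / c2 * (c1 / c2) + ?F \<Delta> = (c1 * c1 + ?F \<Delta> * (c2 * c2)) / (c2 * c2)"
        by (simp add: field_simps)
      then show False using N nonsq[of "c1 / c2"] by simp
    qed
  qed
  have "carries \<Delta> (W_std 1 0) (W_std c1 c2)"
  proof (rule carriesI[OF similitude_scal norm])
    fix v assume "v \<in> (W_std 1 0 :: ('p mod_ring ^ (3 + 3)) set)"
    then obtain e m n where "v = qvec e 0 m n m n" by (auto simp: W_std_def)
    then show "v v* map_matrix of_int (alpha \<Delta> (scal C1 C2)) \<in> W_std c1 c2"
      by (auto simp: qvec_mult_scal Let_def W_std_def lift)
  qed
  from this std_W show "carries \<Delta> (W_std 1 0) W" by (rule carries_trans)
  have "carries \<Delta> (W_std c1 c2) (W_std 1 0)"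
  proof (rule carriesI[OF similitude_scal[of \<Delta> C1 "- C2"]])
    show "\<not> int CARD('p) dvd C1 * C1 + \<Delta> * (- C2 * - C2)" using norm by simp
    fix v assume "v \<in> W_std c1 c2"
    then obtain e m n where v: "v = qvec (e * c1) (e * c2) m n m n" by (auto simp: W_std_def)
    have "v v* map_matrix of_int (alpha \<Delta> (scal C1 (- C2))) =
        (let M = m * c1 + ?F \<Delta> * n * c2; N = n * c1 - m * c2
         in qvec (e * (c1 * c1 + ?F \<Delta> * (c2 * c2)) * 1) (e * (c1 * c1 + ?F \<Delta> * (c2 * c2)) * 0) M N M N)"
      by (simp add: v qvec_mult_scal Let_def lift qvec_simps algebra_simps)
    then show "v v* map_matrix of_int (alpha \<Delta> (scal C1 (- C2))) \<in> W_std 1 0"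
      unfolding W_std_def Let_def by blast
  qed
  with W_std show "carries \<Delta> W (W_std 1 0)" by (rule carries_trans)
qed

theorem theorem3p3p4:
  fixes \<Delta> :: int and R :: "int set" and \<sigma>\<^sub>1 \<sigma>\<^sub>2 :: "('p::prime_card) padic_int mat6"
  assumes "odd CARD('p)"
    and "\<Delta> > 0" and "squarefree \<Delta>"
    and "inert_in CARD('p) (imag_quadratic_field \<Delta>)"
    and "residue_system CARD('p) R"
    and "\<sigma>\<^sub>1 \<in> D4 \<Delta> \<inter> S3_open R" and "\<sigma>\<^sub>2 \<in> D4 \<Delta> \<inter> S3_open R"
  shows "D_equivalent \<Delta> \<sigma>\<^sub>1 \<sigma>\<^sub>2"
proof -
  obtain s where s: "\<sigma>\<^sub>1 = sigma s" "transpose s = s"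
      "vec.dim (quad_span \<Delta> (W_sigma s :: ('p mod_ring ^ (3 + 3)) set)) = 4"
    using assms(6) unfolding D4_def by blast
  obtain t where t: "\<sigma>\<^sub>2 = sigma t" "transpose t = t"
      "vec.dim (quad_span \<Delta> (W_sigma t :: ('p mod_ring ^ (3 + 3)) set)) = 4"
    using assms(7) unfolding D4_def by blast
  have nonsq: "\<not> int CARD('p) dvd a\<^sup>2 + \<Delta>" for a
    using prime_card[where 'a='p] assms(1-4) by (rule inert_imp_no_root)
  have "carries \<Delta> (W_sigma s) (W_sigma t :: ('p mod_ring ^ (3 + 3)) set)"
    using W_sigma_carries(1)[OF assms(1) nonsq s(2,3)] W_sigma_carries(2)[OF assms(1) nonsq t(2,3)]
    by (rule carries_trans)
  then obtain g c where "similitude \<Delta> c g" "\<not> int CARD('p) dvd c"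
      "\<And>v. v \<in> W_sigma s \<Longrightarrow>
        v v* map_matrix of_int (alpha \<Delta> g) \<in> (W_sigma t :: ('p mod_ring ^ (3 + 3)) set)"
    unfolding carries_def by blast
  then show ?thesis
    unfolding s(1) t(1) by (rule D_equivalent_if_mod_p[OF s(2) t(2)])
qed

end
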